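(* Let $n\ge1$ and let $\lambda=(\lambda_1,\dots,\lambda_n)$ be an anti-lecture hall composition of length $n$ bounded above by $1$, i.e. an integer sequence with $1\ge\frac{\lambda_1}{1}\ge\frac{\lambda_2}{2}\ge\cdots\ge\frac{\lambda_n}{n}\ge0$. Then the threshold graph $T(\lambda)$ associated to $\lambda$ is $T(\lambda)=T(n,\sigma)$, where $\sigma$ is the complement in $\{1,\dots,n\}$ of the set of nonzero elements of $\{k-\lambda_k\mid 1\le k\le n\}$.
   Context: For $n\ge 1$ and $\sigma\subseteq\{1,\dots,n\}$, $T(n,\sigma)$ is the graph with vertex set $\{0,1,\dots,n\}$ in which, for $0\le u<v\le n$, the pair $uv$ is an edge if and only if $v\notin\sigma$. (Every threshold graph on $n+1$ vertices is isomorphic to exactly one $T(n,\sigma)$.) Betti sequence of a threshold graph $T=T(n,\sigma)$: let $\Bbbk$ be a field, $R=\Bbbk[x_0,\dots,x_n]$, $I_c(T)=\langle x_ux_v\mid u\neq v,\ uv\notin E(T)\rangle$ and $\Bbbk[T]=R/I_c(T)$. The ideal $I_c(T)$ is $2$-linear, i.e. the graded Betti numbers $\beta_{i,j}(\Bbbk[T])$ vanish unless $j=i+1$ or $(i,j)=(0,0)$. The Betti sequence of $T$ is $\beta(T)=(\beta_1(T),\dots,\beta_n(T))$ with $\beta_i(T)=\beta_{i,i+1}(\Bbbk[T])$. The anti-lecture hall composition associated to $T$ is $\lambda(T)=(\lambda_1(T),\dots,\lambda_n(T))$ with $$\lambda_i(T)=\sum_{k=i}^n(-1)^{i+k}\binom{k-1}{i-1}\beta_k(T).$$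 It is known that $T\mapsto\lambda(T)$ is a bijection from threshold graphs on $n+1$ vertices (up to isomorphism) to anti-lecture hall compositions of length $n$ bounded above by $1$; $T(\lambda)$ denotes the unique threshold graph $T$ with $\lambda(T)=\lambda$. *)

theory Defs
  imports Complex_Main "HOL-Library.Poly_Mapping"
begin

section \<open>Threshold graphs\<close>

text \<open>A simple graph is a pair of a vertex set and a set of two-element subsets of it.\<close>

type_synonym 'v graph = "'v set \<times> 'v set set"

text \<open>Threshold graphs arise from a single vertex by repeatedly adding an isolated or a
  dominating vertex.\<close>

inductive threshold_graph :: "'v graph \<Rightarrow> bool" where
  single_vertex: "threshold_graph ({v}, {})"
| add_isolated: "threshold_graph (V, E) \<Longrightarrow> v \<notin> V \<Longrightarrow> threshold_graph (insert v V, E)"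
| add_dominating: "threshold_graph (V, E) \<Longrightarrow> v \<notin> V \<Longrightarrow>
    threshold_graph (insert v V, E \<union> {{u, v} | u. u \<in> V})"

text \<open>\<open>T_graph n \<sigma>\<close> is \<open>T(n,\<sigma>)\<close>: the vertex \<open>v \<ge> 1\<close> is added as an
  isolated vertex if \<open>v \<in> \<sigma>\<close>, and as a dominating vertex otherwise.\<close>

definition T_graph :: "nat \<Rightarrow> nat set \<Rightarrow> nat graph" where
  "T_graph n \<sigma> = ({0..n}, {{u, v} | u v. u < v \<and> v \<le> n \<and> v \<notin> \<sigma>})"

definition graph_iso :: "'v graph \<Rightarrow> 'w graph \<Rightarrow> bool" where
  "graph_iso G H \<longleftrightarrow> (\<exists>f. bij_betw f (fst G) (fst H) \<and>
     (\<forall>u\<in>fst G. \<forall>v\<in>fst G. {u, v} \<in> snd G \<longleftrightarrow> {f u, f v} \<in> snd H))"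


section \<open>Polynomial rings and ideals\<close>

text \<open>Polynomials with indeterminates indexed by \<open>nat\<close>; \<open>poly_ring V\<close> is the ring
  \<open>\<Bbbk>[x\<^sub>v | v \<in> V]\<close>, with the standard grading.\<close>

type_synonym 'k mpoly = "(nat \<Rightarrow>\<^sub>0 nat) \<Rightarrow>\<^sub>0 'k"

definition poly_ring :: "nat set \<Rightarrow> 'k::field mpoly set" where
  "poly_ring V = {p. \<forall>m\<in>Poly_Mapping.keys p. Poly_Mapping.keys m \<subseteq> V}"

definition indet :: "nat \<Rightarrow> 'k::field mpoly" where
  "indet v = Poly_Mapping.single (Poly_Mapping.single v 1) 1"

definition mdeg :: "(nat \<Rightarrow>\<^sub>0 nat) \<Rightarrow> nat" where
  "mdeg m = (\<Sum>v\<in>Poly_Mapping.keys m. Poly_Mapping.lookup m v)"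

definition ideal_generated :: "nat set \<Rightarrow> 'k::field mpoly set \<Rightarrow> 'k mpoly set" where
  "ideal_generated V B =
     {\<Sum>g\<in>B'. c g * g | c B'. finite B' \<and> B' \<subseteq> B \<and> (\<forall>g\<in>B'. c g \<in> poly_ring V)}"

text \<open>The ideal \<open>I\<^sub>c(T)\<close> of non-edges.\<close>

definition nonedge_ideal :: "nat graph \<Rightarrow> 'k::field mpoly set" where
  "nonedge_ideal T = ideal_generated (fst T)
     {indet u * indet v | u v. u \<in> fst T \<and> v \<in> fst T \<and> u \<noteq> v \<and> {u, v} \<notin> snd T}"


section \<open>Graded Betti numbers\<close>

text \<open>The free module of rank \<open>r\<close> over \<open>poly_ring V\<close>; vectors are padded with zeros.\<close>

definition free_module :: "nat set \<Rightarrow> nat \<Rightarrow> (nat \<Rightarrow> 'k::field mpoly) set" where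
  "free_module V r = {f. (\<forall>a<r. f a \<in> poly_ring V) \<and> (\<forall>a\<ge>r. f a = 0)}"

definition mat_apply ::
  "nat \<Rightarrow> nat \<Rightarrow> (nat \<Rightarrow> nat \<Rightarrow> 'k::field mpoly) \<Rightarrow> (nat \<Rightarrow> 'k mpoly) \<Rightarrow> (nat \<Rightarrow> 'k mpoly)" where
  "mat_apply s r A f = (\<lambda>a. if a < s then \<Sum>b<r. A a b * f b else 0)"

text \<open>Minimal graded free resolutions
  \<open>\<dots> \<rightarrow> F\<^sub>2 \<rightarrow> F\<^sub>1 \<rightarrow> F\<^sub>0 \<rightarrow> R/I \<rightarrow> 0\<close> of a cyclic module, where \<open>R = poly_ring V\<close> and
  \<open>I\<close> is a homogeneous ideal of \<open>R\<close>.  Here \<open>F\<^sub>i\<close> is the direct sum of \<open>R(-d i b)\<close> over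
  \<open>b < r i\<close>; the matrix \<open>A i\<close> represents \<open>F\<^sub>i\<^sub>+\<^sub>1 \<rightarrow> F\<^sub>i\<close>; and \<open>\<epsilon> a\<close> is a
  representative in \<open>R\<close> of the image in \<open>R/I\<close> of the \<open>a\<close>-th basis vector of \<open>F\<^sub>0\<close>.
  The conjuncts say: the augmentation and the differentials are homogeneous of degree \<open>0\<close>; the
  augmented complex is exact at \<open>R/I\<close>, at \<open>F\<^sub>0\<close> and at \<open>F\<^sub>i\<^sub>+\<^sub>1\<close>; and the image
  of \<open>F\<^sub>i\<^sub>+\<^sub>1\<close> lies in \<open>\<mm>F\<^sub>i\<close>, where \<open>\<mm>\<close> is the ideal of all indeterminates.
  Since \<open>R/I\<close> lives in nonnegative degrees, a minimal resolution has no negative shifts, so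
  natural numbers suffice for the shifts.\<close>

definition minimal_graded_free_resolution ::
  "nat set \<Rightarrow> 'k::field mpoly set \<Rightarrow> (nat \<Rightarrow> nat) \<Rightarrow> (nat \<Rightarrow> nat \<Rightarrow> nat) \<Rightarrow>
   (nat \<Rightarrow> nat \<Rightarrow> nat \<Rightarrow> 'k mpoly) \<Rightarrow> (nat \<Rightarrow> 'k mpoly) \<Rightarrow> bool" where
  "minimal_graded_free_resolution V I r d A \<epsilon> \<longleftrightarrow>
     (\<forall>a<r 0. \<epsilon> a \<in> poly_ring V \<and> (\<forall>m\<in>Poly_Mapping.keys (\<epsilon> a). mdeg m = d 0 a)) \<and>
     (\<forall>i. \<forall>a<r i. \<forall>b<r (Suc i). A i a b \<in> poly_ring V \<and>
        (\<forall>m\<in>Poly_Mapping.keys (A i a b). mdeg m + d i a = d (Suc i) b)) \<and>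
     (\<forall>p\<in>poly_ring V. \<exists>f\<in>free_module V (r 0). p - (\<Sum>a<r 0. f a * \<epsilon> a) \<in> I) \<and>
     {f \<in> free_module V (r 0). (\<Sum>a<r 0. f a * \<epsilon> a) \<in> I} =
       mat_apply (r 0) (r 1) (A 0) ` free_module V (r 1) \<and>
     (\<forall>i. {f \<in> free_module V (r (Suc i)). mat_apply (r i) (r (Suc i)) (A i) f = (\<lambda>_. 0)} =
       mat_apply (r (Suc i)) (r (Suc (Suc i))) (A (Suc i)) ` free_module V (r (Suc (Suc i)))) \<and>
     (\<forall>i. \<forall>a<r i. \<forall>b<r (Suc i). Poly_Mapping.lookup (A i a b) 0 = 0)"

text \<open>\<open>\<beta>\<^sub>i\<^sub>,\<^sub>j(R/I)\<close>: the number of summands \<open>R(-j)\<close> of \<open>F\<^sub>i\<close> in a minimal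
  graded free resolution of \<open>R/I\<close>.\<close>

definition graded_betti :: "nat set \<Rightarrow> 'k::field mpoly set \<Rightarrow> nat \<Rightarrow> nat \<Rightarrow> nat" where
  "graded_betti V I i j = (THE c. \<exists>r d A \<epsilon>. minimal_graded_free_resolution V I r d A \<epsilon> \<and>
     c = card {b. b < r i \<and> d i b = j})"

definition betti_seq :: "'k::field itself \<Rightarrow> nat graph \<Rightarrow> nat \<Rightarrow> nat" where
  "betti_seq _ T i = graded_betti (fst T) (nonedge_ideal T :: 'k mpoly set) i (i + 1)"


section \<open>Anti-lecture hall compositions\<close>

text \<open>Compositions of length \<open>n\<close> are functions on \<open>nat\<close>, of which only the values at
  \<open>1, \<dots>, n\<close> matter.\<close>

definition anti_lecture_hall_upto_1 :: "nat \<Rightarrow> (nat \<Rightarrow> int) \<Rightarrow> bool" where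
  "anti_lecture_hall_upto_1 n lam \<longleftrightarrow>
     (1::real) \<ge> of_int (lam 1) / of_nat 1 \<and>
     (\<forall>i\<in>{1..<n}. (of_int (lam i) / of_nat i :: real) \<ge> of_int (lam (i + 1)) / of_nat (i + 1)) \<and>
     (of_int (lam n) / of_nat n :: real) \<ge> 0"

text \<open>The composition \<open>\<lambda>(T)\<close> of a threshold graph on \<open>n + 1\<close> vertices.\<close>

definition lambda_comp :: "'k::field itself \<Rightarrow> nat \<Rightarrow> nat graph \<Rightarrow> nat \<Rightarrow> int" where
  "lambda_comp K n T i =
     (\<Sum>k=i..n. (-1) ^ (i + k) * int ((k - 1) choose (i - 1)) * int (betti_seq K T k))"

definition threshold_graph_with_comp ::
  "'k::field itself \<Rightarrow> nat \<Rightarrow> (nat \<Rightarrow> int) \<Rightarrow> nat graph \<Rightarrow> bool" where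
  "threshold_graph_with_comp K n lam T \<longleftrightarrow>
     threshold_graph T \<and> card (fst T) = n + 1 \<and> (\<forall>i\<in>{1..n}. lambda_comp K n T i = lam i)"

text \<open>\<open>T = T(\<lambda>)\<close>, i.e. \<open>T\<close> is the threshold graph with composition \<open>\<lambda>\<close>, which is
  unique up to isomorphism.\<close>

definition is_T_of ::
  "'k::field itself \<Rightarrow> nat \<Rightarrow> (nat \<Rightarrow> int) \<Rightarrow> nat graph \<Rightarrow> bool" where
  "is_T_of K n lam T \<longleftrightarrow> threshold_graph_with_comp K n lam T \<and>
     (\<forall>T'. threshold_graph_with_comp K n lam T' \<longrightarrow> graph_iso T' T)"

end

theory Submission
  imports Defs "HOL-Library.Function_Algebras"
begin

text \<open>The ideal of non-edges of \<open>T(n,\<sigma>)\<close> is generated by the \<open>x\<^sub>u x\<^sub>v\<close> with \<open>u < v \<in> \<sigma>\<close>, and it has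
  linear quotients.  Iterated mapping cones therefore give a linear, hence minimal, resolution in which
  a generator whose colon ideal is generated by \<open>c\<close> indeterminates contributes \<open>c choose (i - 1)\<close> to
  \<open>\<beta>\<^sub>i\<close>.  The transformation from \<open>\<beta>\<close> to \<open>\<lambda>\<close> is binomial inversion, so \<open>\<lambda>\<^sub>i\<close> is the number of generators
  with \<open>c = i - 1\<close>.  If \<open>t \<notin> \<sigma>\<close> and \<open>m\<close> is the number of elements of \<open>\<sigma>\<close> above \<open>t\<close>, then
  \<open>\<lambda>\<^sub>t\<^sub>+\<^sub>m = m\<close>; this recovers the complement of \<open>\<sigma>\<close> as the set of nonzero \<open>k - \<lambda>\<^sub>k\<close>.\<close>

section \<open>Polynomials and monomial ideals\<close>

text \<open>\<open>graded_betti\<close> is a definite description over all minimal resolutions, so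
  one explicit resolution determines it only after the number of generators in each degree is known
  to be independent of the resolution; much of the algebra serves this. For existence no
  differential is ever written down: a mapping cone is controlled through its ranks and shifts
  alone, and the shifts 0, 2, 3, 4, ... force every matrix entry to be homogeneous of degree 1 or 2,
  so that it has no constant term. Ideals are handled as upward closed sets of exponents; the colon
  by a monomial with exponent \<open>a\<close> is then a preimage under translation by
  \<open>a\<close>, and for squarefree generators everything reduces to supports. Uniqueness of
  T(\<lambda>) requires the compositions of all threshold graphs, not only of
  \<open>T_graph n \<sigma>\<close>. Therefore resolutions and Betti numbers are computed for an
  arbitrary labelling \<open>f\<close> of the vertices, and the set belonging to a labelling is
  recovered from its generator counts.\<close>

definition filter_terms :: "('a \<Rightarrow> bool) \<Rightarrow> ('a \<Rightarrow>\<^sub>0 'b::comm_monoid_add) \<Rightarrow> 'a \<Rightarrow>\<^sub>0 'b" where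
  "filter_terms P p = (\<Sum>m\<in>{m\<in>Poly_Mapping.keys p. P m}. Poly_Mapping.single m (Poly_Mapping.lookup p m))"

lemma lookup_filter_terms: "Poly_Mapping.lookup (filter_terms P p) m = (if P m then Poly_Mapping.lookup p m else 0)"
proof -
  have "Poly_Mapping.lookup (filter_terms P p) m =
     (\<Sum>x\<in>{m\<in>Poly_Mapping.keys p. P m}. if x = m then Poly_Mapping.lookup p x else 0)"
    unfolding filter_terms_def lookup_sum by (rule sum.cong) (auto simp: lookup_single when_def)
  then show ?thesis
    by (simp add: in_keys_iff)
qed

lemma keys_filter_terms: "Poly_Mapping.keys (filter_terms P p) = {m \<in> Poly_Mapping.keys p. P m}"
  by (auto simp: in_keys_iff lookup_filter_terms split: if_splits)

lemma filter_terms_add: "filter_terms P (p + q) = filter_terms P p + filter_terms P q"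
  by (rule poly_mapping_eqI) (simp add: lookup_filter_terms lookup_add)

lemma filter_terms_minus: "filter_terms P (p - q :: _ \<Rightarrow>\<^sub>0 _::ab_group_add) = filter_terms P p - filter_terms P q"
  by (rule poly_mapping_eqI) (simp add: lookup_filter_terms lookup_minus)

lemma filter_terms_sum: "filter_terms P (\<Sum>i\<in>A. f i) = (\<Sum>i\<in>A. filter_terms P (f i))"
  by (rule poly_mapping_eqI) (simp add: lookup_filter_terms lookup_sum)

lemma filter_terms_id: "(\<And>m. m \<in> Poly_Mapping.keys p \<Longrightarrow> P m) \<Longrightarrow> filter_terms P p = p"
  by (rule poly_mapping_eqI) (auto simp: lookup_filter_terms in_keys_iff)

lemma filter_terms_eq_0: "(\<And>m. m \<in> Poly_Mapping.keys p \<Longrightarrow> \<not> P m) \<Longrightarrow> filter_terms P p = 0"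
  by (rule poly_mapping_eqI) (auto simp: lookup_filter_terms in_keys_iff)

lemma filter_terms_decomp: "filter_terms P p + filter_terms (\<lambda>m. \<not> P m) p = p"
  by (rule poly_mapping_eqI) (simp add: lookup_filter_terms lookup_add)

lemma sum_singles: "p = (\<Sum>m\<in>Poly_Mapping.keys p. Poly_Mapping.single m (Poly_Mapping.lookup p m))"
proof -
  have "{m \<in> Poly_Mapping.keys p. True} = Poly_Mapping.keys p" by simp
  then show ?thesis
    using filter_terms_def[of "\<lambda>_. True" p] filter_terms_id[of p "\<lambda>_. True"] by simp
qed

text \<open>Taking a homogeneous component commutes with multiplication by a homogeneous
  \<open>p\<close>, because all terms of \<open>p\<close> shift the predicate in the same way. This
  is what turns arbitrary lifts into graded ones.\<close>

lemma filter_terms_mult_left: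
  fixes p q :: "(nat \<Rightarrow>\<^sub>0 nat) \<Rightarrow>\<^sub>0 'k::field"
  assumes "\<And>a m. a \<in> Poly_Mapping.keys p \<Longrightarrow> P (a + m) \<longleftrightarrow> Q m"
  shows "p * filter_terms Q q = filter_terms P (p * q)"
proof -
  have "filter_terms P (p * q) = filter_terms P (p * filter_terms Q q) + filter_terms P (p * filter_terms (\<lambda>m. \<not> Q m) q)"
    using arg_cong[OF filter_terms_decomp[of Q q], of "\<lambda>x. filter_terms P (p * x)"]
    by (simp only: distrib_left filter_terms_add)
  also have "filter_terms P (p * filter_terms Q q) = p * filter_terms Q q"
  proof (rule filter_terms_id)
    fix m assume "m \<in> Poly_Mapping.keys (p * filter_terms Q q)"
    then obtain a b where "m = a + b" "a \<in> Poly_Mapping.keys p" "b \<in> Poly_Mapping.keys (filter_terms Q q)"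
      using keys_mult[of p "filter_terms Q q"] by blast
    then show "P m" using assms by (auto simp: keys_filter_terms)
  qed
  also have "filter_terms P (p * filter_terms (\<lambda>m. \<not> Q m) q) = 0"
  proof (rule filter_terms_eq_0)
    fix m assume "m \<in> Poly_Mapping.keys (p * filter_terms (\<lambda>m. \<not> Q m) q)"
    then obtain a b where "m = a + b" "a \<in> Poly_Mapping.keys p" "b \<in> Poly_Mapping.keys (filter_terms (\<lambda>m. \<not> Q m) q)"
      using keys_mult[of p "filter_terms (\<lambda>m. \<not> Q m) q"] by blast
    then show "\<not> P m" using assms by (auto simp: keys_filter_terms)
  qed
  finally show ?thesis by simp
qed

lemma poly_mapping_const_split: "p = Poly_Mapping.single m (Poly_Mapping.lookup p m) + filter_terms (\<lambda>x. x \<noteq> m) p"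
  by (rule poly_mapping_eqI) (simp add: lookup_filter_terms lookup_add lookup_single when_def)

lemma add_eq_0_poly_mapping_nat: "(a::nat \<Rightarrow>\<^sub>0 nat) + b = 0 \<longleftrightarrow> a = 0 \<and> b = 0"
proof
  assume *: "a + b = 0"
  have "Poly_Mapping.lookup a k + Poly_Mapping.lookup b k = 0" for k
    using arg_cong[OF *, of "\<lambda>x. Poly_Mapping.lookup x k"] by (simp add: lookup_add)
  then show "a = 0 \<and> b = 0" by (auto intro!: poly_mapping_eqI)
qed simp

abbreviation const_coeff :: "'k::field mpoly \<Rightarrow> 'k" where
  "const_coeff p \<equiv> Poly_Mapping.lookup p 0"

text \<open>Natural exponents cannot cancel, so only 0 + 0 contributes to the constant term. Taking
  constant coefficients is thus reduction modulo the ideal of all indeterminates.\<close>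

lemma const_coeff_mult:
  fixes p q :: "'k::field mpoly"
  shows "const_coeff (p * q) = const_coeff p * const_coeff q"
proof -
  have z: "const_coeff (p * q) = 0" if "0 \<notin> Poly_Mapping.keys p \<or> 0 \<notin> Poly_Mapping.keys q" for p q :: "'k mpoly"
  proof (rule ccontr)
    assume "const_coeff (p * q) \<noteq> 0"
    then have "0 \<in> Poly_Mapping.keys (p * q)" by (simp add: in_keys_iff)
    then obtain a b where "0 = a + b" "a \<in> Poly_Mapping.keys p" "b \<in> Poly_Mapping.keys q"
      using keys_mult[of p q] by blast
    then show False using that add_eq_0_poly_mapping_nat[of a b] by auto
  qed
  let ?p = "Poly_Mapping.single 0 (const_coeff p)" and ?p' = "filter_terms (\<lambda>x. x \<noteq> 0) p"
  let ?q = "Poly_Mapping.single 0 (const_coeff q)" and ?q' = "filter_terms (\<lambda>x. x \<noteq> 0) q"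
  have "p * q = ?p * ?q + (?p' * ?q + p * ?q')"
  proof -
    have "p * q = (?p + ?p') * ?q + p * ?q'"
      using arg_cong[OF poly_mapping_const_split[of q 0], of "\<lambda>x. p * x"]
        poly_mapping_const_split[of p 0] by (simp only: distrib_left)
    then show ?thesis by (simp only: distrib_right add.assoc)
  qed
  then have "const_coeff (p * q) = const_coeff (?p * ?q) + (const_coeff (?p' * ?q) + const_coeff (p * ?q'))"
    by (simp add: lookup_add)
  also have "const_coeff (?p' * ?q) = 0" by (rule z) (simp add: keys_filter_terms)
  also have "const_coeff (p * ?q') = 0" by (rule z) (simp add: keys_filter_terms)
  finally show ?thesis by (simp add: mult_single)
qed

text \<open>Translation by \<open>a\<close> is injective on exponents, so no terms merge or
  cancel.\<close>

lemma keys_single_mult: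
  fixes p :: "'k::field mpoly"
  shows "Poly_Mapping.keys (Poly_Mapping.single a 1 * p) = (+) a ` Poly_Mapping.keys p"
proof
  show "Poly_Mapping.keys (Poly_Mapping.single a 1 * p) \<subseteq> (+) a ` Poly_Mapping.keys p"
    using keys_mult[of "Poly_Mapping.single a 1" p] by auto
next
  have "Poly_Mapping.lookup (Poly_Mapping.single a 1 * p) (a + m) = Poly_Mapping.lookup p m" for m
  proof -
    let ?s = "Poly_Mapping.single m (Poly_Mapping.lookup p m)" and ?r = "filter_terms (\<lambda>x. x \<noteq> m) p"
    have "a + m \<notin> Poly_Mapping.keys (Poly_Mapping.single a 1 * ?r)"
      using keys_mult[of "Poly_Mapping.single a 1" ?r] by (auto simp: keys_filter_terms split: if_splits)
    then have "Poly_Mapping.lookup (Poly_Mapping.single a 1 * ?r) (a + m) = 0"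
      by (simp add: in_keys_iff)
    moreover have "Poly_Mapping.single a 1 * p = Poly_Mapping.single a 1 * ?s + Poly_Mapping.single a 1 * ?r"
      using arg_cong[OF poly_mapping_const_split[of p m], of "\<lambda>x. Poly_Mapping.single a 1 * x"]
      by (simp only: distrib_left)
    ultimately show ?thesis by (simp add: lookup_add mult_single)
  qed
  then show "(+) a ` Poly_Mapping.keys p \<subseteq> Poly_Mapping.keys (Poly_Mapping.single a 1 * p)"
    by (auto simp: in_keys_iff)
qed

lemma keys_add_monomial: "Poly_Mapping.keys (a + b :: nat \<Rightarrow>\<^sub>0 nat) = Poly_Mapping.keys a \<union> Poly_Mapping.keys b"
  by (auto simp: in_keys_iff lookup_add)

lemma mdeg_eq: "finite A \<Longrightarrow> Poly_Mapping.keys m \<subseteq> A \<Longrightarrow> mdeg m = (\<Sum>v\<in>A. Poly_Mapping.lookup m v)"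
  unfolding mdeg_def by (rule sum.mono_neutral_left) (auto simp: in_keys_iff)

lemma mdeg_add: "mdeg (a + b) = mdeg a + mdeg b"
  by (simp add: mdeg_eq[of "Poly_Mapping.keys a \<union> Poly_Mapping.keys b"] keys_add_monomial lookup_add sum.distrib)

lemma mdeg_single [simp]: "mdeg (Poly_Mapping.single v k) = k"
  by (cases "k = 0") (simp_all add: mdeg_def)

lemma mdeg_zero [simp]: "mdeg 0 = 0"
  by (simp add: mdeg_def)

lemma poly_ring_zero [simp, intro]: "0 \<in> poly_ring V"
  by (simp add: poly_ring_def)

lemma poly_ring_one [simp, intro]: "1 \<in> poly_ring V"
  by (simp add: poly_ring_def)

lemma poly_ring_add [intro]: "p \<in> poly_ring V \<Longrightarrow> q \<in> poly_ring V \<Longrightarrow> p + q \<in> poly_ring V"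
  using keys_add[of p q] by (auto simp: poly_ring_def)

lemma poly_ring_uminus [intro]: "p \<in> poly_ring V \<Longrightarrow> - p \<in> poly_ring V"
  by (auto simp: poly_ring_def in_keys_iff)

lemma poly_ring_minus [intro]: "p \<in> poly_ring V \<Longrightarrow> q \<in> poly_ring V \<Longrightarrow> p - q \<in> poly_ring V"
  using poly_ring_add[OF _ poly_ring_uminus, of p V q] by simp

lemma poly_ring_mult [intro]: "p \<in> poly_ring V \<Longrightarrow> q \<in> poly_ring V \<Longrightarrow> p * q \<in> poly_ring V"
  using keys_mult[of p q] by (fastforce simp: poly_ring_def keys_add_monomial)

lemma poly_ring_sum [intro]: "(\<And>i. i \<in> A \<Longrightarrow> f i \<in> poly_ring V) \<Longrightarrow> (\<Sum>i\<in>A. f i) \<in> poly_ring V"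
  by (induction A rule: infinite_finite_induct) auto

lemma poly_ring_filter_terms [intro]: "p \<in> poly_ring V \<Longrightarrow> filter_terms P p \<in> poly_ring V"
  by (auto simp: poly_ring_def keys_filter_terms)

lemma poly_ring_single [intro]: "Poly_Mapping.keys a \<subseteq> V \<Longrightarrow> Poly_Mapping.single a c \<in> poly_ring V"
  by (auto simp: poly_ring_def split: if_splits)

text \<open>\<open>M\<close> is meant to be closed under adding exponents; describing the ideal by
  all its exponents, not by generators, makes membership a condition on each term
  separately.\<close>

definition mono_ideal :: "nat set \<Rightarrow> (nat \<Rightarrow>\<^sub>0 nat) set \<Rightarrow> 'k::field mpoly set" where
  "mono_ideal V M = {p \<in> poly_ring V. Poly_Mapping.keys p \<subseteq> M}"

text \<open>The condition \<open>mdeg m + x = y\<close> selects the component of degree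
  \<open>y - x\<close> without subtracting naturals, in the shape in which shifts appear in graded
  matrices.\<close>

definition homogeneous_ideal :: "nat set \<Rightarrow> 'k::field mpoly set \<Rightarrow> bool" where
  "homogeneous_ideal V I \<longleftrightarrow> 0 \<in> I \<and> (\<forall>p\<in>I. \<forall>q\<in>I. p + q \<in> I) \<and>
     (\<forall>c\<in>poly_ring V. \<forall>p\<in>I. c * p \<in> I) \<and> (\<forall>p\<in>I. \<forall>x y. filter_terms (\<lambda>m. mdeg m + x = y) p \<in> I)"

lemma homogeneous_ideal_mono_ideal:
  assumes "\<And>m a. m \<in> M \<Longrightarrow> a + m \<in> M"
  shows "homogeneous_ideal V (mono_ideal V M :: 'k::field mpoly set)"
  unfolding homogeneous_ideal_def mono_ideal_def
proof (intro conjI ballI allI)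
  fix c p :: "'k mpoly" assume "c \<in> poly_ring V" "p \<in> {p \<in> poly_ring V. Poly_Mapping.keys p \<subseteq> M}"
  then show "c * p \<in> {p \<in> poly_ring V. Poly_Mapping.keys p \<subseteq> M}"
    using keys_mult[of c p] assms by (auto 0 3)
next
  fix p q :: "'k mpoly" assume "p \<in> {p \<in> poly_ring V. Poly_Mapping.keys p \<subseteq> M}" "q \<in> {p \<in> poly_ring V. Poly_Mapping.keys p \<subseteq> M}"
  then show "p + q \<in> {p \<in> poly_ring V. Poly_Mapping.keys p \<subseteq> M}"
    using keys_add[of p q] by auto
qed (auto simp: keys_filter_terms)

section \<open>Graded free resolutions\<close>

lemma sum_fun_apply: "(\<Sum>i\<in>A. f i) x = (\<Sum>i\<in>A. f i x :: 'a::comm_monoid_add)"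
  by (induction A rule: infinite_finite_induct) auto

text \<open>The columns of a matrix with a left inverse are independent vectors in the span of
  \<open>card J'\<close> unit vectors. Arbitrary finite index sets are allowed because only the
  basis vectors of one degree will be selected.\<close>

lemma card_le_of_left_inverse:
  fixes f g :: "nat \<Rightarrow> nat \<Rightarrow> 'k::field"
  assumes J: "finite J" "finite J'"
    and inv: "\<And>b b'. b \<in> J \<Longrightarrow> b' \<in> J \<Longrightarrow> (\<Sum>a\<in>J'. g b a * f a b') = (if b = b' then 1 else 0)"
  shows "card J \<le> card J'"
proof -
  interpret fs: vector_space "\<lambda>c (v :: nat \<Rightarrow> 'k) x. c * v x"
    by unfold_locales (auto simp: fun_eq_iff algebra_simps)
  define s where "s = (\<lambda>b a. if a \<in> J' then f a b else 0)"
  define e where "e = (\<lambda>(a::nat) (x::nat). if x = a then 1 else 0 :: 'k)"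
  have inv': "(\<Sum>a\<in>J'. g b a * s b' a) = (if b = b' then 1 else 0)" if "b \<in> J" "b' \<in> J" for b b'
    using inv[OF that] by (simp add: s_def)
  have inj: "inj_on s J"
  proof (rule inj_onI)
    fix b b' assume "b \<in> J" "b' \<in> J" "s b = s b'"
    then show "b = b'" using inv'[of b b] inv'[of b b'] by (auto split: if_splits)
  qed
  have "fs.independent (s ` J)"
    unfolding fs.dependent_finite[OF finite_imageI[OF J(1)]]
  proof (rule notI, elim exE conjE bexE)
    fix u v assume v: "v \<in> s ` J" "u v \<noteq> 0" and z: "(\<Sum>v\<in>s ` J. (\<lambda>x. u v * v x)) = 0"
    obtain b where b: "b \<in> J" "v = s b" using v by auto
    have z': "(\<Sum>b'\<in>J. u (s b') * s b' a) = 0" for a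
    proof -
      have "(\<Sum>b'\<in>J. u (s b') * s b' a) = (\<Sum>v\<in>s ` J. (\<lambda>x. u v * v x)) a"
        by (simp add: sum.reindex[OF inj] sum_fun_apply)
      then show ?thesis using z by simp
    qed
    \<comment> \<open>Pairing the vanishing combination with row \<open>b\<close> of the left
      inverse isolates the coefficient of \<open>s b\<close>.\<close>
    have "u v = (\<Sum>b'\<in>J. u (s b') * (\<Sum>a\<in>J'. g b a * s b' a))"
      using b J by (simp add: inv' if_distrib cong: if_cong)
    also have "\<dots> = (\<Sum>a\<in>J'. g b a * (\<Sum>b'\<in>J. u (s b') * s b' a))"
      unfolding sum_distrib_left by (subst sum.swap) (simp add: mult_ac)
    finally show False using v z' by simp
  qed
  moreover have "s ` J \<subseteq> fs.span (e ` J')"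
  proof
    fix v assume "v \<in> s ` J"
    then obtain b where b: "v = s b" by auto
    have "s b = (\<Sum>a\<in>J'. (\<lambda>x. f a b * e a x))"
      by (rule ext) (use J in \<open>simp add: s_def e_def sum_fun_apply if_distrib cong: if_cong\<close>)
    also have "\<dots> \<in> fs.span (e ` J')"
      by (intro fs.span_sum fs.span_scale fs.span_base) auto
    finally show "v \<in> fs.span (e ` J')" using b by simp
  qed
  ultimately have "card (s ` J) \<le> card (e ` J')"
    using fs.independent_span_bound[of "e ` J'" "s ` J"] J by auto
  also have "\<dots> \<le> card J'" using J by (simp add: card_image_le)
  finally show ?thesis using inj by (simp add: card_image)
qed

section \<open>Matrices of polynomials, gradings and syzygies\<close>

definition mat_prod :: "nat \<Rightarrow> (nat \<Rightarrow> nat \<Rightarrow> 'a::comm_ring_1) \<Rightarrow> (nat \<Rightarrow> nat \<Rightarrow> 'a) \<Rightarrow> nat \<Rightarrow> nat \<Rightarrow> 'a" where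
  "mat_prod r A B = (\<lambda>a b. \<Sum>c<r. A a c * B c b)"

lemma mat_prod_assoc: "mat_prod q (mat_prod r A B) C = mat_prod r A (mat_prod q B C)"
proof (intro ext)
  fix a b
  show "mat_prod q (mat_prod r A B) C a b = mat_prod r A (mat_prod q B C) a b"
    unfolding mat_prod_def sum_distrib_left sum_distrib_right
    by (subst sum.swap) (simp add: mult.assoc)
qed

lemma mat_prod_cong:
  assumes "\<And>c. c < r \<Longrightarrow> A a c = A' a' c" "\<And>c. c < r \<Longrightarrow> B c b = B' c b'"
  shows "mat_prod r A B a b = mat_prod r A' B' a' b'"
  unfolding mat_prod_def using assms by (intro sum.cong) auto

lemma mat_prod_in_poly_ring:
  assumes "\<And>c. c < r \<Longrightarrow> A a c \<in> poly_ring V" "\<And>c. c < r \<Longrightarrow> B c b \<in> poly_ring V"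
  shows "mat_prod r A B a b \<in> poly_ring V"
  unfolding mat_prod_def using assms by (intro poly_ring_sum poly_ring_mult) auto

definition graded_mat :: "nat set \<Rightarrow> nat \<Rightarrow> (nat \<Rightarrow> nat) \<Rightarrow> nat \<Rightarrow> (nat \<Rightarrow> nat) \<Rightarrow> (nat \<Rightarrow> nat \<Rightarrow> 'k::field mpoly) \<Rightarrow> bool" where
  "graded_mat V r d q e B \<longleftrightarrow> (\<forall>a<r. \<forall>b<q. B a b \<in> poly_ring V \<and>
     (\<forall>m\<in>Poly_Mapping.keys (B a b). mdeg m + d a = e b))"

lemma graded_mat_mprod:
  assumes "graded_mat V r d s e A" "graded_mat V s e q e' B"
  shows "graded_mat V r d q e' (mat_prod s A B)"
  unfolding graded_mat_def
proof (intro allI impI conjI ballI)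
  fix a b assume ab: "a < r" "b < q"
  show "mat_prod s A B a b \<in> poly_ring V"
    using assms ab by (intro mat_prod_in_poly_ring) (auto simp: graded_mat_def)
  fix m assume "m \<in> Poly_Mapping.keys (mat_prod s A B a b)"
  then obtain c where c: "c < s" "m \<in> Poly_Mapping.keys (A a c * B c b)"
    using keys_sum[of "\<lambda>c. A a c * B c b" "{..<s}"] unfolding mat_prod_def by auto
  then obtain m1 m2 where m: "m = m1 + m2" "m1 \<in> Poly_Mapping.keys (A a c)" "m2 \<in> Poly_Mapping.keys (B c b)"
    using keys_mult by blast
  have "mdeg m1 + d a = e c" "mdeg m2 + e c = e' b"
    using m c ab assms unfolding graded_mat_def by blast+
  then show "mdeg m + d a = e' b"
    using m(1) by (simp add: mdeg_add)
qed

definition mat_col :: "nat \<Rightarrow> (nat \<Rightarrow> nat \<Rightarrow> 'a::zero) \<Rightarrow> nat \<Rightarrow> nat \<Rightarrow> 'a" where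
  "mat_col r B b = (\<lambda>a. if a < r then B a b else 0)"

text \<open>At index 0 this is the kernel of the augmentation to \<open>R/I\<close>, afterwards the
  kernel of the preceding differential. One name lets the lifting arguments treat all spots
  alike.\<close>

definition syzygies :: "nat set \<Rightarrow> 'k::field mpoly set \<Rightarrow> (nat \<Rightarrow> nat) \<Rightarrow> (nat \<Rightarrow> nat \<Rightarrow> nat \<Rightarrow> 'k mpoly) \<Rightarrow>
    (nat \<Rightarrow> 'k mpoly) \<Rightarrow> nat \<Rightarrow> (nat \<Rightarrow> 'k mpoly) set" where
  "syzygies V I r A \<epsilon> i = (case i of
     0 \<Rightarrow> {f \<in> free_module V (r 0). (\<Sum>a<r 0. f a * \<epsilon> a) \<in> I}
   | Suc j \<Rightarrow> {f \<in> free_module V (r (Suc j)). mat_apply (r j) (r (Suc j)) (A j) f = (\<lambda>_. 0)})"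

lemma mat_col_in_free_module: "mat_col r B b \<in> free_module V r \<longleftrightarrow> (\<forall>a<r. B a b \<in> poly_ring V)"
  by (auto simp: mat_col_def free_module_def)

lemma mat_apply_col: "mat_apply s r A (mat_col r B b) = mat_col s (mat_prod r A B) b"
  by (auto simp: mat_apply_def mat_col_def mat_prod_def fun_eq_iff)

lemma mat_col_eq_0_iff: "mat_col r B b = (\<lambda>_. 0) \<longleftrightarrow> (\<forall>a<r. B a b = 0)"
  by (auto simp: mat_col_def fun_eq_iff)

lemma mat_col_eq_iff: "mat_col r B b = mat_col r C c \<longleftrightarrow> (\<forall>a<r. B a b = C a c)"
  by (auto simp: mat_col_def fun_eq_iff)

text \<open>Minimality is imposed in a separate locale: lifting arguments rest on exactness, and the
  iterated cones are recognised as minimal only when they are complete.\<close>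

locale graded_resolution =
  fixes V :: "nat set" and I :: "'k::field mpoly set" and r :: "nat \<Rightarrow> nat"
    and d :: "nat \<Rightarrow> nat \<Rightarrow> nat" and A :: "nat \<Rightarrow> nat \<Rightarrow> nat \<Rightarrow> 'k mpoly" and \<epsilon> :: "nat \<Rightarrow> 'k mpoly"
  assumes ideal: "homogeneous_ideal V I"
    and aug: "a < r 0 \<Longrightarrow> \<epsilon> a \<in> poly_ring V" "a < r 0 \<Longrightarrow> m \<in> Poly_Mapping.keys (\<epsilon> a) \<Longrightarrow> mdeg m = d 0 a"
    and graded_mat: "graded_mat V (r i) (d i) (r (Suc i)) (d (Suc i)) (A i)"
    and surj: "p \<in> poly_ring V \<Longrightarrow> \<exists>f\<in>free_module V (r 0). p - (\<Sum>a<r 0. f a * \<epsilon> a) \<in> I"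
    and exact: "syzygies V I r A \<epsilon> i = mat_apply (r i) (r (Suc i)) (A i) ` free_module V (r (Suc i))"
begin

abbreviation "Z \<equiv> syzygies V I r A \<epsilon>"

lemma mat_col_in_syzygies_Suc:
  "mat_col (r (Suc i)) X b \<in> Z (Suc i) \<longleftrightarrow>
    (\<forall>a<r (Suc i). X a b \<in> poly_ring V) \<and> (\<forall>a<r i. mat_prod (r (Suc i)) (A i) X a b = 0)"
  by (simp add: syzygies_def mat_col_in_free_module mat_apply_col mat_col_eq_0_iff)

lemma mat_col_in_syzygies_0:
  "mat_col (r 0) X b \<in> Z 0 \<longleftrightarrow> (\<forall>a<r 0. X a b \<in> poly_ring V) \<and> (\<Sum>a<r 0. X a b * \<epsilon> a) \<in> I"
proof -
  have "(\<Sum>a<r 0. mat_col (r 0) X b a * \<epsilon> a) = (\<Sum>a<r 0. X a b * \<epsilon> a)"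
    by (simp add: mat_col_def)
  then show ?thesis by (simp add: syzygies_def mat_col_in_free_module)
qed

lemma A_in_poly_ring: "a < r i \<Longrightarrow> b < r (Suc i) \<Longrightarrow> A i a b \<in> poly_ring V"
  using graded_mat[of i] by (simp add: graded_mat_def)

lemma column_in_syzygies:
  assumes "b < r (Suc i)"
  shows "mat_col (r i) (A i) b \<in> Z i"
proof -
  let ?E = "\<lambda>x y :: nat. if x = y then 1 else 0 :: 'k mpoly"
  have "mat_col (r (Suc i)) ?E b \<in> free_module V (r (Suc i))"
    by (auto simp: mat_col_in_free_module)
  then have "mat_col (r i) (mat_prod (r (Suc i)) (A i) ?E) b \<in> Z i"
    unfolding exact mat_apply_col[symmetric] by blast
  moreover have "mat_col (r i) (mat_prod (r (Suc i)) (A i) ?E) b = mat_col (r i) (A i) b"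
    using assms by (simp add: mat_col_eq_iff mat_prod_def if_distrib cong: if_cong)
  ultimately show ?thesis by simp
qed

lemma differential_square:
  assumes "a < r i" "b < r (Suc (Suc i))"
  shows "mat_prod (r (Suc i)) (A i) (A (Suc i)) a b = 0"
  using column_in_syzygies[OF assms(2)] assms(1) by (simp add: mat_col_in_syzygies_Suc)

section \<open>Lifting through exact complexes, chain maps and homotopies\<close>

lemma lift:
  assumes "\<And>b. b < q \<Longrightarrow> mat_col (r i) B b \<in> Z i"
  obtains C where "\<And>c b. c < r (Suc i) \<Longrightarrow> b < q \<Longrightarrow> C c b \<in> poly_ring V"
    and "\<And>a b. a < r i \<Longrightarrow> b < q \<Longrightarrow> B a b = mat_prod (r (Suc i)) (A i) C a b"
proof -
  have "\<forall>b. \<exists>f. b < q \<longrightarrow> f \<in> free_module V (r (Suc i)) \<and> mat_col (r i) B b = mat_apply (r i) (r (Suc i)) (A i) f"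
    using assms unfolding exact by blast
  then obtain F where F: "\<And>b. b < q \<Longrightarrow> F b \<in> free_module V (r (Suc i))"
    "\<And>b. b < q \<Longrightarrow> mat_col (r i) B b = mat_apply (r i) (r (Suc i)) (A i) (F b)"
    by metis
  show ?thesis
  proof (rule that[of "\<lambda>c b. F b c"])
    fix c b assume "c < r (Suc i)" "b < q" then show "F b c \<in> poly_ring V"
      using F(1) by (simp add: free_module_def)
  next
    fix a b assume "a < r i" "b < q"
    then show "B a b = mat_prod (r (Suc i)) (A i) (\<lambda>c b. F b c) a b"
      using fun_cong[OF F(2), of b a] by (simp add: mat_col_def mat_apply_def mat_prod_def)
  qed
qed

lemma graded_lift:
  assumes B: "graded_mat V (r i) (d i) q e B" and Z: "\<And>b. b < q \<Longrightarrow> mat_col (r i) B b \<in> Z i"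
  obtains C where "graded_mat V (r (Suc i)) (d (Suc i)) q e C"
    and "\<And>a b. a < r i \<Longrightarrow> b < q \<Longrightarrow> B a b = mat_prod (r (Suc i)) (A i) C a b"
proof -
  obtain C where C: "\<And>c b. c < r (Suc i) \<Longrightarrow> b < q \<Longrightarrow> C c b \<in> poly_ring V"
    "\<And>a b. a < r i \<Longrightarrow> b < q \<Longrightarrow> B a b = mat_prod (r (Suc i)) (A i) C a b"
    using lift[OF Z] by blast
  \<comment> \<open>An arbitrary lift becomes graded when each entry is cut down to its component of the right degree.\<close>
  define C' where "C' = (\<lambda>c b. filter_terms (\<lambda>m. mdeg m + d (Suc i) c = e b) (C c b))"
  show ?thesis
  proof (rule that[of C'])
    show "graded_mat V (r (Suc i)) (d (Suc i)) q e C'"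
      using C(1) by (auto simp: graded_mat_def C'_def keys_filter_terms)
    fix a b assume ab: "a < r i" "b < q"
    have "B a b = filter_terms (\<lambda>m. mdeg m + d i a = e b) (B a b)"
      by (rule filter_terms_id[symmetric]) (use B ab in \<open>auto simp: graded_mat_def\<close>)
    also have "\<dots> = (\<Sum>c<r (Suc i). filter_terms (\<lambda>m. mdeg m + d i a = e b) (A i a c * C c b))"
      using C(2)[OF ab] by (simp add: mat_prod_def filter_terms_sum)
    also have "\<dots> = (\<Sum>c<r (Suc i). A i a c * C' c b)"
    proof (intro sum.cong refl)
      fix c assume "c \<in> {..<r (Suc i)}"
      then have "\<And>m. m \<in> Poly_Mapping.keys (A i a c) \<Longrightarrow> mdeg m + d i a = d (Suc i) c"
        using graded_mat[of i] ab by (auto simp: graded_mat_def)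
      then show "filter_terms (\<lambda>m. mdeg m + d i a = e b) (A i a c * C c b) = A i a c * C' c b"
        unfolding C'_def by (intro filter_terms_mult_left[symmetric]) (force simp: mdeg_add)
    qed
    finally show "B a b = mat_prod (r (Suc i)) (A i) C' a b" by (simp add: mat_prod_def)
  qed
qed

text \<open>Existence half of the comparison theorem. The source is any graded complex and the start
  \<open>\<phi>0\<close> is prescribed, so the lemma serves both for comparing two resolutions and
  for lifting multiplication by a monomial.\<close>

lemma comparison:
  assumes B: "\<And>i. graded_mat V (q i) (e i) (q (Suc i)) (e (Suc i)) (B i)"
    and BB: "\<And>i a b. a < q i \<Longrightarrow> b < q (Suc (Suc i)) \<Longrightarrow> mat_prod (q (Suc i)) (B i) (B (Suc i)) a b = 0"
    and \<phi>0: "graded_mat V (r 0) (d 0) (q 0) (e 0) \<phi>0"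
    and Z0: "\<And>b. b < q 1 \<Longrightarrow> mat_col (r 0) (mat_prod (q 0) \<phi>0 (B 0)) b \<in> Z 0"
  shows "\<exists>\<phi>. (\<forall>i. graded_mat V (r i) (d i) (q i) (e i) (\<phi> i)) \<and> \<phi> 0 = \<phi>0 \<and>
    (\<forall>i. \<forall>a<r i. \<forall>b<q (Suc i).
      mat_prod (q i) (\<phi> i) (B i) a b = mat_prod (r (Suc i)) (A i) (\<phi> (Suc i)) a b)"
proof -
  \<comment> \<open>\<open>P\<close> contains what the next lift requires, namely that the composite
    with \<open>B i\<close> has its columns in the kernel; hence the choice has to remember only the
    last map.\<close>
  define P where "P = (\<lambda>i \<phi>. graded_mat V (r i) (d i) (q i) (e i) \<phi> \<and> (i = 0 \<longrightarrow> \<phi> = \<phi>0) \<and>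
    (\<forall>b<q (Suc i). mat_col (r i) (mat_prod (q i) \<phi> (B i)) b \<in> Z i))"
  define Q where "Q = (\<lambda>i \<phi> \<phi>'. \<forall>a<r i. \<forall>b<q (Suc i).
    mat_prod (q i) \<phi> (B i) a b = mat_prod (r (Suc i)) (A i) \<phi>' a b)"
  have "\<exists>\<phi>. \<forall>i. P i (\<phi> i) \<and> Q i (\<phi> i) (\<phi> (Suc i))"
  proof (rule dependent_nat_choice)
    show "\<exists>\<phi>. P 0 \<phi>" using \<phi>0 Z0 by (auto simp: P_def)
    fix \<phi> i assume P: "P i \<phi>"
    have "graded_mat V (r i) (d i) (q (Suc i)) (e (Suc i)) (mat_prod (q i) \<phi> (B i))"
      using P B[of i] by (auto simp: P_def intro: graded_mat_mprod)
    then obtain C where C: "graded_mat V (r (Suc i)) (d (Suc i)) (q (Suc i)) (e (Suc i)) C"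
      and eq: "\<And>a b. a < r i \<Longrightarrow> b < q (Suc i) \<Longrightarrow> mat_prod (q i) \<phi> (B i) a b = mat_prod (r (Suc i)) (A i) C a b"
      by (rule graded_lift) (use P in \<open>auto simp: P_def\<close>)
    have "mat_col (r (Suc i)) (mat_prod (q (Suc i)) C (B (Suc i))) b \<in> Z (Suc i)" if b: "b < q (Suc (Suc i))" for b
      unfolding mat_col_in_syzygies_Suc
    proof (intro conjI allI impI)
      fix a assume "a < r (Suc i)"
      then show "mat_prod (q (Suc i)) C (B (Suc i)) a b \<in> poly_ring V"
        using graded_mat_mprod[OF C B[of "Suc i"]] b by (simp add: graded_mat_def)
    next
      fix a assume a: "a < r i"
      have "mat_prod (r (Suc i)) (A i) (mat_prod (q (Suc i)) C (B (Suc i))) a b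
          = mat_prod (q (Suc i)) (mat_prod (q i) \<phi> (B i)) (B (Suc i)) a b"
        unfolding mat_prod_assoc[symmetric] by (rule mat_prod_cong) (use eq a in auto)
      also have "\<dots> = mat_prod (q i) \<phi> (\<lambda>_ _. 0) a b"
        unfolding mat_prod_assoc by (rule mat_prod_cong) (use BB b in auto)
      finally show "mat_prod (r (Suc i)) (A i) (mat_prod (q (Suc i)) C (B (Suc i))) a b = 0"
        by (simp add: mat_prod_def)
    qed
    then have "P (Suc i) C \<and> Q i \<phi> C"
      using C eq by (auto simp: P_def Q_def)
    then show "\<exists>\<phi>'. P (Suc i) \<phi>' \<and> Q i \<phi> \<phi>'" by blast
  qed
  then obtain \<phi> where "\<And>i. P i (\<phi> i)" "\<And>i. Q i (\<phi> i) (\<phi> (Suc i))" by blast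
  then show ?thesis by (intro exI[of _ \<phi>]) (simp add: P_def Q_def)
qed

text \<open>Homotopy half of the comparison theorem: \<open>Z0\<close> says that \<open>w\<close>
  induces zero on \<open>R/I\<close>. No degrees are recorded for \<open>h\<close>, since the later
  argument uses only that each product contains a differential as a factor.\<close>

lemma nullhomotopy:
  assumes w: "\<And>i a b. a < r i \<Longrightarrow> b < r i \<Longrightarrow> w i a b \<in> poly_ring V"
    and comm: "\<And>i a b. a < r i \<Longrightarrow> b < r (Suc i) \<Longrightarrow>
      mat_prod (r i) (w i) (A i) a b = mat_prod (r (Suc i)) (A i) (w (Suc i)) a b"
    and Z0: "\<And>b. b < r 0 \<Longrightarrow> mat_col (r 0) (w 0) b \<in> Z 0"
  shows "\<exists>h. (\<forall>a<r 0. \<forall>b<r 0. w 0 a b = mat_prod (r 1) (A 0) (h 0) a b) \<and>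
    (\<forall>i. \<forall>a<r (Suc i). \<forall>b<r (Suc i).
      w (Suc i) a b = mat_prod (r (Suc (Suc i))) (A (Suc i)) (h (Suc i)) a b + mat_prod (r i) (h i) (A i) a b)"
proof -
  \<comment> \<open>The middle clause is what remains of the homotopy equation for
    \<open>w i\<close> after multiplication by \<open>A i\<close>: the summand with the previous
    homotopy dies because two consecutive differentials compose to zero. It makes the correction
    \<open>X\<close> below a cycle.\<close>
  define P where "P = (\<lambda>i h. (\<forall>a<r (Suc i). \<forall>b<r i. h a b \<in> poly_ring V) \<and>
    (\<forall>a<r i. \<forall>b<r (Suc i). mat_prod (r i) (w i) (A i) a b = mat_prod (r i) (mat_prod (r (Suc i)) (A i) h) (A i) a b) \<and>
    (i = 0 \<longrightarrow> (\<forall>a<r 0. \<forall>b<r 0. w 0 a b = mat_prod (r 1) (A 0) h a b)))"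
  define Q where "Q = (\<lambda>i h h'. \<forall>a<r (Suc i). \<forall>b<r (Suc i).
    w (Suc i) a b = mat_prod (r (Suc (Suc i))) (A (Suc i)) h' a b + mat_prod (r i) h (A i) a b)"
  have "\<exists>h. \<forall>i. P i (h i) \<and> Q i (h i) (h (Suc i))"
  proof (rule dependent_nat_choice)
    obtain h where "\<And>c b. c < r (Suc 0) \<Longrightarrow> b < r 0 \<Longrightarrow> h c b \<in> poly_ring V"
      and eq: "\<And>a b. a < r 0 \<Longrightarrow> b < r 0 \<Longrightarrow> w 0 a b = mat_prod (r (Suc 0)) (A 0) h a b"
      using lift[OF Z0] by blast
    moreover have "mat_prod (r 0) (w 0) (A 0) a b = mat_prod (r 0) (mat_prod (r (Suc 0)) (A 0) h) (A 0) a b"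
      if "a < r 0" "b < r (Suc 0)" for a b
      by (rule mat_prod_cong) (use eq that in auto)
    ultimately show "\<exists>h. P 0 h" unfolding P_def by auto
    fix h i assume P: "P i h"
    define X where "X = (\<lambda>a b. w (Suc i) a b - mat_prod (r i) h (A i) a b)"
    have "mat_col (r (Suc i)) X b \<in> Z (Suc i)" if b: "b < r (Suc i)" for b
      unfolding mat_col_in_syzygies_Suc
    proof (intro conjI allI impI)
      fix a assume "a < r (Suc i)"
      then show "X a b \<in> poly_ring V"
        unfolding X_def using P b w A_in_poly_ring[of _ i]
        by (intro poly_ring_minus mat_prod_in_poly_ring) (auto simp: P_def)
    next
      fix a assume a: "a < r i"
      have "mat_prod (r (Suc i)) (A i) X a b = mat_prod (r (Suc i)) (A i) (w (Suc i)) a b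
          - mat_prod (r (Suc i)) (A i) (mat_prod (r i) h (A i)) a b"
        by (simp add: X_def mat_prod_def right_diff_distrib sum_subtractf)
      also have "\<dots> = 0"
        using P a b comm[of a i b] by (simp add: P_def mat_prod_assoc)
      finally show "mat_prod (r (Suc i)) (A i) X a b = 0" .
    qed
    then obtain h' where h': "\<And>c b. c < r (Suc (Suc i)) \<Longrightarrow> b < r (Suc i) \<Longrightarrow> h' c b \<in> poly_ring V"
      and eq: "\<And>a b. a < r (Suc i) \<Longrightarrow> b < r (Suc i) \<Longrightarrow> X a b = mat_prod (r (Suc (Suc i))) (A (Suc i)) h' a b"
      using lift[of "r (Suc i)" "Suc i" X] by blast
    have Q: "Q i h h'"
      using eq by (auto simp: Q_def X_def algebra_simps)
    have "mat_prod (r (Suc i)) (w (Suc i)) (A (Suc i)) a b =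
        mat_prod (r (Suc i)) (mat_prod (r (Suc (Suc i))) (A (Suc i)) h') (A (Suc i)) a b"
      if ab: "a < r (Suc i)" "b < r (Suc (Suc i))" for a b
    proof -
      have "mat_prod (r (Suc i)) (w (Suc i)) (A (Suc i)) a b =
        mat_prod (r (Suc i)) (\<lambda>a b. mat_prod (r (Suc (Suc i))) (A (Suc i)) h' a b + mat_prod (r i) h (A i) a b) (A (Suc i)) a b"
        by (rule mat_prod_cong) (use Q ab in \<open>auto simp: Q_def\<close>)
      also have "\<dots> = mat_prod (r (Suc i)) (mat_prod (r (Suc (Suc i))) (A (Suc i)) h') (A (Suc i)) a b
         + mat_prod (r (Suc i)) (mat_prod (r i) h (A i)) (A (Suc i)) a b"
        by (simp add: mat_prod_def[of "r (Suc i)"] distrib_right sum.distrib)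
      also have "mat_prod (r (Suc i)) (mat_prod (r i) h (A i)) (A (Suc i)) a b = mat_prod (r i) h (\<lambda>_ _. 0) a b"
        unfolding mat_prod_assoc by (rule mat_prod_cong) (use differential_square ab in auto)
      also have "\<dots> = 0" by (simp add: mat_prod_def)
      finally show ?thesis by simp
    qed
    then have "P (Suc i) h'" using h' by (auto simp: P_def)
    then show "\<exists>h'. P (Suc i) h' \<and> Q i h h'" using Q by blast
  qed
  then obtain h where "\<And>i. P i (h i)" "\<And>i. Q i (h i) (h (Suc i))" by blast
  then show ?thesis by (intro exI[of _ h]) (simp add: P_def Q_def)
qed

end

section \<open>Comparison of two resolutions of the same quotient\<close>

context graded_resolution
begin

lemma ideal_zero: "0 \<in> I"
  using ideal by (simp add: homogeneous_ideal_def)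

lemma ideal_add: "p \<in> I \<Longrightarrow> p' \<in> I \<Longrightarrow> p + p' \<in> I"
  using ideal by (simp add: homogeneous_ideal_def)

lemma ideal_mult: "c \<in> poly_ring V \<Longrightarrow> p \<in> I \<Longrightarrow> c * p \<in> I"
  using ideal by (simp add: homogeneous_ideal_def)

lemma ideal_filter_terms: "p \<in> I \<Longrightarrow> filter_terms (\<lambda>m. mdeg m + x = y) p \<in> I"
  using ideal by (simp add: homogeneous_ideal_def)

lemma ideal_minus: "p \<in> I \<Longrightarrow> p' \<in> I \<Longrightarrow> p - p' \<in> I"
  using ideal_add[of p "-1 * p'"] ideal_mult[of "-1" p'] by auto

lemma ideal_sum: "(\<And>x. x \<in> X \<Longrightarrow> f x \<in> I) \<Longrightarrow> (\<Sum>x\<in>X. f x) \<in> I"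
  by (induction X rule: infinite_finite_induct) (auto intro: ideal_zero ideal_add)

lemma augmentation_lift:
  assumes "\<And>b. b < q \<Longrightarrow> \<eta> b \<in> poly_ring V"
    and deg: "\<And>b m. b < q \<Longrightarrow> m \<in> Poly_Mapping.keys (\<eta> b) \<Longrightarrow> mdeg m = e b"
  obtains \<phi> where "graded_mat V (r 0) (d 0) q e \<phi>"
    and "\<And>b. b < q \<Longrightarrow> \<eta> b - (\<Sum>a<r 0. \<phi> a b * \<epsilon> a) \<in> I"
proof -
  have "\<forall>b. \<exists>f. b < q \<longrightarrow> f \<in> free_module V (r 0) \<and> \<eta> b - (\<Sum>a<r 0. f a * \<epsilon> a) \<in> I"
    using surj assms(1) by blast
  then obtain F where F: "\<And>b. b < q \<Longrightarrow> F b \<in> free_module V (r 0)"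
      "\<And>b. b < q \<Longrightarrow> \<eta> b - (\<Sum>a<r 0. F b a * \<epsilon> a) \<in> I"
    by metis
  define \<phi> where "\<phi> = (\<lambda>a b. filter_terms (\<lambda>m. mdeg m + d 0 a = e b) (F b a))"
  show ?thesis
  proof (rule that[of \<phi>])
    show "graded_mat V (r 0) (d 0) q e \<phi>"
      using F(1) by (auto simp: graded_mat_def \<phi>_def keys_filter_terms free_module_def)
    fix b assume b: "b < q"
    \<comment> \<open>The summand 0 gives the degree filter the shape required by
      \<open>ideal_filter_terms\<close>.\<close>
    let ?R = "filter_terms (\<lambda>m. mdeg m + 0 = e b)"
    have "?R (\<eta> b - (\<Sum>a<r 0. F b a * \<epsilon> a)) = ?R (\<eta> b) - (\<Sum>a<r 0. ?R (\<epsilon> a * F b a))"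
      by (simp add: filter_terms_minus filter_terms_sum mult.commute)
    also have "?R (\<eta> b) = \<eta> b"
      by (rule filter_terms_id) (use deg b in auto)
    also have "(\<Sum>a<r 0. ?R (\<epsilon> a * F b a)) = (\<Sum>a<r 0. \<phi> a b * \<epsilon> a)"
    proof (intro sum.cong refl)
      fix a assume "a \<in> {..<r 0}"
      then have "\<epsilon> a * filter_terms (\<lambda>m. mdeg m + d 0 a = e b) (F b a) = ?R (\<epsilon> a * F b a)"
        by (intro filter_terms_mult_left) (auto simp: mdeg_add aug add_ac)
      then show "?R (\<epsilon> a * F b a) = \<phi> a b * \<epsilon> a"
        by (simp add: \<phi>_def mult.commute)
    qed
    finally show "\<eta> b - (\<Sum>a<r 0. \<phi> a b * \<epsilon> a) \<in> I"
      using ideal_filter_terms[OF F(2)[OF b], of 0 "e b"] by simp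
  qed
qed

lemma resolution_comparison:
  assumes "graded_resolution V I q e B \<eta>"
  obtains \<phi> where "\<And>i. graded_mat V (r i) (d i) (q i) (e i) (\<phi> i)"
    and "\<And>b. b < q 0 \<Longrightarrow> \<eta> b - (\<Sum>a<r 0. \<phi> 0 a b * \<epsilon> a) \<in> I"
    and "\<And>i a b. a < r i \<Longrightarrow> b < q (Suc i) \<Longrightarrow>
      mat_prod (q i) (\<phi> i) (B i) a b = mat_prod (r (Suc i)) (A i) (\<phi> (Suc i)) a b"
proof -
  interpret G: graded_resolution V I q e B \<eta> by fact
  obtain \<phi>0 where \<phi>0: "graded_mat V (r 0) (d 0) (q 0) (e 0) \<phi>0"
    and aug0: "\<And>b. b < q 0 \<Longrightarrow> \<eta> b - (\<Sum>a<r 0. \<phi>0 a b * \<epsilon> a) \<in> I"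
    using augmentation_lift[of "q 0" \<eta> "e 0"] G.aug by blast
  have kern0: "mat_col (r 0) (mat_prod (q 0) \<phi>0 (B 0)) b \<in> Z 0" if b: "b < q 1" for b
    unfolding mat_col_in_syzygies_0
  proof (intro conjI allI impI)
    fix a assume "a < r 0"
    then show "mat_prod (q 0) \<phi>0 (B 0) a b \<in> poly_ring V"
      using graded_mat_mprod[OF \<phi>0 G.graded_mat[of 0]] b by (simp add: graded_mat_def)
  next
    \<comment> \<open>Modulo \<open>I\<close> this is the combination of the \<open>\<eta> c\<close>
      with coefficients from a column of \<open>B 0\<close>, which lies in \<open>I\<close> because
      that column is a syzygy.\<close>
    have "(\<Sum>a<r 0. mat_prod (q 0) \<phi>0 (B 0) a b * \<epsilon> a) = (\<Sum>c<q 0. B 0 c b * (\<Sum>a<r 0. \<phi>0 a c * \<epsilon> a))"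
      unfolding mat_prod_def sum_distrib_left sum_distrib_right
      by (subst sum.swap) (simp add: mult_ac)
    also have "\<dots> = (\<Sum>c<q 0. B 0 c b * \<eta> c) - (\<Sum>c<q 0. B 0 c b * (\<eta> c - (\<Sum>a<r 0. \<phi>0 a c * \<epsilon> a)))"
      by (simp add: right_diff_distrib sum_subtractf)
    also have "\<dots> \<in> I"
    proof (rule ideal_minus)
      show "(\<Sum>c<q 0. B 0 c b * \<eta> c) \<in> I"
        using G.column_in_syzygies[of b 0] b by (simp add: G.mat_col_in_syzygies_0)
      show "(\<Sum>c<q 0. B 0 c b * (\<eta> c - (\<Sum>a<r 0. \<phi>0 a c * \<epsilon> a))) \<in> I"
        using b aug0 G.A_in_poly_ring[of _ 0 b] by (intro ideal_sum ideal_mult) auto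
    qed
    finally show "(\<Sum>a<r 0. mat_prod (q 0) \<phi>0 (B 0) a b * \<epsilon> a) \<in> I" .
  qed
  have "\<exists>\<phi>. (\<forall>i. graded_mat V (r i) (d i) (q i) (e i) (\<phi> i)) \<and> \<phi> 0 = \<phi>0 \<and>
    (\<forall>i. \<forall>a<r i. \<forall>b<q (Suc i).
      mat_prod (q i) (\<phi> i) (B i) a b = mat_prod (r (Suc i)) (A i) (\<phi> (Suc i)) a b)"
    by (rule comparison) (fact G.graded_mat G.differential_square \<phi>0 kern0)+
  then obtain \<phi> where "\<And>i. graded_mat V (r i) (d i) (q i) (e i) (\<phi> i)" "\<phi> 0 = \<phi>0"
    "\<And>i a b. a < r i \<Longrightarrow> b < q (Suc i) \<Longrightarrow>
      mat_prod (q i) (\<phi> i) (B i) a b = mat_prod (r (Suc i)) (A i) (\<phi> (Suc i)) a b"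
    by blast
  then show ?thesis using aug0 by (intro that[of \<phi>]) auto
qed

end

section \<open>Minimal resolutions and invariance of their Betti numbers\<close>

locale minimal_resolution = graded_resolution +
  assumes minimal: "a < r i \<Longrightarrow> b < r (Suc i) \<Longrightarrow> const_coeff (A i a b) = 0"
begin

lemma const_coeff_mprod_left [simp]:
  "b < r (Suc i) \<Longrightarrow> const_coeff (mat_prod (r i) h (A i) a b) = 0"
  by (simp add: mat_prod_def lookup_sum const_coeff_mult minimal)

lemma const_coeff_mprod_right [simp]:
  "a < r i \<Longrightarrow> const_coeff (mat_prod (r (Suc i)) (A i) h a b) = 0"
  by (simp add: mat_prod_def lookup_sum const_coeff_mult minimal)

text \<open>Comparison maps \<open>\<phi>\<close>, \<open>\<psi>\<close> in both directions exist; \<open>\<psi> \<circ> \<phi>\<close> is homotopic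
  to the identity, and both terms of the homotopy vanish modulo the ideal of all indeterminates by
  minimality.  So the constant parts of \<open>\<phi>\<close> and \<open>\<psi>\<close>, which preserve the shifts, exhibit a
  left inverse over the field.\<close>

lemma betti_le:
  assumes "graded_resolution V I q e B \<eta>"
  shows "card {b. b < r i \<and> d i b = j} \<le> card {b. b < q i \<and> e i b = j}"
proof -
  interpret G: graded_resolution V I q e B \<eta> by fact
  obtain \<phi> where \<phi>: "\<And>i. graded_mat V (q i) (e i) (r i) (d i) (\<phi> i)"
    "\<And>b. b < r 0 \<Longrightarrow> \<epsilon> b - (\<Sum>a<q 0. \<phi> 0 a b * \<eta> a) \<in> I"
    "\<And>i a b. a < q i \<Longrightarrow> b < r (Suc i) \<Longrightarrow>
      mat_prod (r i) (\<phi> i) (A i) a b = mat_prod (q (Suc i)) (B i) (\<phi> (Suc i)) a b"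
    using G.resolution_comparison[OF graded_resolution_axioms] by blast
  obtain \<psi> where \<psi>: "\<And>i. graded_mat V (r i) (d i) (q i) (e i) (\<psi> i)"
    "\<And>b. b < q 0 \<Longrightarrow> \<eta> b - (\<Sum>a<r 0. \<psi> 0 a b * \<epsilon> a) \<in> I"
    "\<And>i a b. a < r i \<Longrightarrow> b < q (Suc i) \<Longrightarrow>
      mat_prod (q i) (\<psi> i) (B i) a b = mat_prod (r (Suc i)) (A i) (\<psi> (Suc i)) a b"
    using resolution_comparison[OF G.graded_resolution_axioms] by blast
  define \<delta> where "\<delta> = (\<lambda>a b :: nat. if a = b then 1 else 0 :: 'a mpoly)"
  define w where "w = (\<lambda>i a b. mat_prod (q i) (\<psi> i) (\<phi> i) a b - \<delta> a b)"
  have w_ring: "w i a b \<in> poly_ring V" if "a < r i" "b < r i" for i a b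
    using graded_mat_mprod[OF \<psi>(1) \<phi>(1), of i] that by (auto simp: w_def \<delta>_def graded_mat_def)
  have w_comm: "mat_prod (r i) (w i) (A i) a b = mat_prod (r (Suc i)) (A i) (w (Suc i)) a b"
    if ab: "a < r i" "b < r (Suc i)" for i a b
  proof -
    have "mat_prod (r i) (w i) (A i) a b = mat_prod (r i) (mat_prod (q i) (\<psi> i) (\<phi> i)) (A i) a b - mat_prod (r i) \<delta> (A i) a b"
      by (simp add: w_def mat_prod_def[of "r i"] left_diff_distrib sum_subtractf)
    also have "mat_prod (r i) \<delta> (A i) a b = A i a b"
      using ab by (simp add: mat_prod_def \<delta>_def if_distrib[of "\<lambda>x. x * _"] cong: if_cong)
    also have "mat_prod (r i) (mat_prod (q i) (\<psi> i) (\<phi> i)) (A i) a b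
        = mat_prod (q i) (\<psi> i) (mat_prod (q (Suc i)) (B i) (\<phi> (Suc i))) a b"
      unfolding mat_prod_assoc by (rule mat_prod_cong) (use \<phi>(3) ab in auto)
    also have "\<dots> = mat_prod (q (Suc i)) (mat_prod (r (Suc i)) (A i) (\<psi> (Suc i))) (\<phi> (Suc i)) a b"
      unfolding mat_prod_assoc[symmetric] by (rule mat_prod_cong) (use \<psi>(3) ab in auto)
    also have "A i a b = mat_prod (r (Suc i)) (A i) \<delta> a b"
      using ab by (simp add: mat_prod_def \<delta>_def if_distrib cong: if_cong)
    also have "mat_prod (q (Suc i)) (mat_prod (r (Suc i)) (A i) (\<psi> (Suc i))) (\<phi> (Suc i)) a b - mat_prod (r (Suc i)) (A i) \<delta> a b
        = mat_prod (r (Suc i)) (A i) (w (Suc i)) a b"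
      by (simp only: w_def mat_prod_assoc)
        (simp add: mat_prod_def[of "r (Suc i)" "A i"] right_diff_distrib sum_subtractf)
    finally show ?thesis .
  qed
  have w_kern: "mat_col (r 0) (w 0) b \<in> Z 0" if b: "b < r 0" for b
    unfolding mat_col_in_syzygies_0
  proof (intro conjI allI impI)
    fix a assume "a < r 0" then show "w 0 a b \<in> poly_ring V" using w_ring b by simp
  next
    have "(\<Sum>a<r 0. mat_prod (q 0) (\<psi> 0) (\<phi> 0) a b * \<epsilon> a) = (\<Sum>c<q 0. \<phi> 0 c b * (\<Sum>a<r 0. \<psi> 0 a c * \<epsilon> a))"
      unfolding mat_prod_def sum_distrib_left sum_distrib_right
      by (subst sum.swap) (simp add: mult_ac)
    moreover have "(\<Sum>a<r 0. \<delta> a b * \<epsilon> a) = \<epsilon> b"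
      using b by (simp add: \<delta>_def if_distrib[of "\<lambda>x. x * _"] cong: if_cong)
    \<comment> \<open>The defect of the composite splits into the augmentation error of
      \<open>\<phi>\<close> and a combination of the augmentation errors of \<open>\<psi>\<close>,
      all of which lie in \<open>I\<close>.\<close>
    ultimately have "(\<Sum>a<r 0. w 0 a b * \<epsilon> a) = 0 - (\<Sum>c<q 0. \<phi> 0 c b * (\<eta> c - (\<Sum>a<r 0. \<psi> 0 a c * \<epsilon> a)))
       - (\<epsilon> b - (\<Sum>a<q 0. \<phi> 0 a b * \<eta> a))"
      by (simp add: w_def left_diff_distrib right_diff_distrib sum_subtractf)
    also have "\<dots> \<in> I"
    proof (intro ideal_minus[OF ideal_minus[OF ideal_zero]])
      show "(\<Sum>c<q 0. \<phi> 0 c b * (\<eta> c - (\<Sum>a<r 0. \<psi> 0 a c * \<epsilon> a))) \<in> I"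
        using \<phi>(1)[of 0] \<psi>(2) b by (intro ideal_sum ideal_mult) (auto simp: graded_mat_def)
    qed (use \<phi>(2) b in auto)
    finally show "(\<Sum>a<r 0. w 0 a b * \<epsilon> a) \<in> I" .
  qed
  have "\<exists>h. (\<forall>a<r 0. \<forall>b<r 0. w 0 a b = mat_prod (r 1) (A 0) (h 0) a b) \<and>
    (\<forall>i. \<forall>a<r (Suc i). \<forall>b<r (Suc i).
      w (Suc i) a b = mat_prod (r (Suc (Suc i))) (A (Suc i)) (h (Suc i)) a b + mat_prod (r i) (h i) (A i) a b)"
    by (rule nullhomotopy) (fact w_ring w_comm w_kern)+
  then obtain h where
    h: "\<forall>a<r 0. \<forall>b<r 0. w 0 a b = mat_prod (r 1) (A 0) (h 0) a b"
    "\<forall>i. \<forall>a<r (Suc i). \<forall>b<r (Suc i).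
      w (Suc i) a b = mat_prod (r (Suc (Suc i))) (A (Suc i)) (h (Suc i)) a b + mat_prod (r i) (h i) (A i) a b"
    by (elim exE conjE)
  have w0: "const_coeff (w i a b) = 0" if "a < r i" "b < r i" for a b
  proof (cases i)
    case 0
    then show ?thesis using that h(1) const_coeff_mprod_right[of a 0 "h 0" b] by simp
  next
    case (Suc k)
    then have "w i a b = mat_prod (r (Suc i)) (A i) (h i) a b + mat_prod (r k) (h k) (A k) a b"
      using that h(2) by simp
    then show ?thesis
      using that Suc const_coeff_mprod_right[of a i "h i" b] const_coeff_mprod_left[of b k "h k" a]
      by (simp add: lookup_add)
  qed
  let ?J = "{b. b < r i \<and> d i b = j}" and ?J' = "{b. b < q i \<and> e i b = j}"
  show ?thesis
  proof (rule card_le_of_left_inverse[where g = "\<lambda>a c. const_coeff (\<psi> i a c)" and f = "\<lambda>c b. const_coeff (\<phi> i c b)"])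
    fix a b assume ab: "a \<in> ?J" "b \<in> ?J"
    \<comment> \<open>An entry of \<open>\<phi> i\<close> can have a constant term only between
      basis vectors of equal degree, so the full sum reduces to the \<open>c\<close> of degree
      \<open>j\<close>.\<close>
    have "(\<Sum>c\<in>?J'. const_coeff (\<psi> i a c) * const_coeff (\<phi> i c b)) = (\<Sum>c<q i. const_coeff (\<psi> i a c) * const_coeff (\<phi> i c b))"
    proof (rule sum.mono_neutral_left)
      show "\<forall>c\<in>{..<q i} - ?J'. const_coeff (\<psi> i a c) * const_coeff (\<phi> i c b) = 0"
      proof
        fix c assume c: "c \<in> {..<q i} - ?J'"
        have "0 \<notin> Poly_Mapping.keys (\<phi> i c b)"
          using \<phi>(1)[of i] c ab unfolding graded_mat_def by fastforce
        then show "const_coeff (\<psi> i a c) * const_coeff (\<phi> i c b) = 0" by (simp add: in_keys_iff)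
      qed
    qed auto
    also have "\<dots> = const_coeff (w i a b) + const_coeff (\<delta> a b)"
      by (simp add: w_def lookup_minus mat_prod_def lookup_sum const_coeff_mult)
    also have "\<dots> = (if a = b then 1 else 0)"
      using w0 ab by (simp add: \<delta>_def)
    finally show "(\<Sum>c\<in>?J'. const_coeff (\<psi> i a c) * const_coeff (\<phi> i c b)) = (if a = b then 1 else 0)" .
  qed auto
qed

end

text \<open>The definition leaves the homogeneity of \<open>I\<close> to its context, while the
  locale includes it; apart from this only the exactness conditions have to be regrouped.\<close>

lemma minimal_graded_free_resolution_iff:
  assumes "homogeneous_ideal V I"
  shows "minimal_graded_free_resolution V I r d A \<epsilon> \<longleftrightarrow> minimal_resolution V I r d A \<epsilon>"
proof -
  have all_nat: "(\<forall>i. P i) \<longleftrightarrow> P 0 \<and> (\<forall>i. P (Suc i))" for P :: "nat \<Rightarrow> bool"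
  proof (intro iffI allI)
    fix i assume "P 0 \<and> (\<forall>i. P (Suc i))" then show "P i" by (cases i) auto
  qed auto
  have "(\<forall>i. syzygies V I r A \<epsilon> i = mat_apply (r i) (r (Suc i)) (A i) ` free_module V (r (Suc i))) \<longleftrightarrow>
     {f \<in> free_module V (r 0). (\<Sum>a<r 0. f a * \<epsilon> a) \<in> I} =
       mat_apply (r 0) (r 1) (A 0) ` free_module V (r 1) \<and>
     (\<forall>i. {f \<in> free_module V (r (Suc i)). mat_apply (r i) (r (Suc i)) (A i) f = (\<lambda>_. 0)} =
       mat_apply (r (Suc i)) (r (Suc (Suc i))) (A (Suc i)) ` free_module V (r (Suc (Suc i))))"
    unfolding all_nat[of "\<lambda>i. syzygies V I r A \<epsilon> i = mat_apply (r i) (r (Suc i)) (A i) ` free_module V (r (Suc i))"]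
    by (simp only: syzygies_def nat.case One_nat_def)
  note ex = this
  show ?thesis
  proof
    assume M: "minimal_graded_free_resolution V I r d A \<epsilon>"
    note M' = M[unfolded minimal_graded_free_resolution_def]
    show "minimal_resolution V I r d A \<epsilon>"
    proof unfold_locales
      show "syzygies V I r A \<epsilon> i = mat_apply (r i) (r (Suc i)) (A i) ` free_module V (r (Suc i))" for i
        using M' ex by meson
    qed (use M' assms in \<open>simp_all add: graded_mat_def\<close>)
  next
    assume "minimal_resolution V I r d A \<epsilon>"
    then interpret F: minimal_resolution V I r d A \<epsilon> .
    show "minimal_graded_free_resolution V I r d A \<epsilon>"
      unfolding minimal_graded_free_resolution_def
    proof (intro conjI)
      show "\<forall>a<r 0. \<epsilon> a \<in> poly_ring V \<and> (\<forall>m\<in>Poly_Mapping.keys (\<epsilon> a). mdeg m = d 0 a)"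
        using F.aug by blast
      show "\<forall>i. \<forall>a<r i. \<forall>b<r (Suc i). A i a b \<in> poly_ring V \<and>
        (\<forall>m\<in>Poly_Mapping.keys (A i a b). mdeg m + d i a = d (Suc i) b)"
        using F.graded_mat by (simp add: graded_mat_def)
      show "\<forall>p\<in>poly_ring V. \<exists>f\<in>free_module V (r 0). p - (\<Sum>a<r 0. f a * \<epsilon> a) \<in> I"
        using F.surj by blast
      show "\<forall>i. \<forall>a<r i. \<forall>b<r (Suc i). const_coeff (A i a b) = 0"
        using F.minimal by blast
    qed (use ex F.exact in blast)+
  qed
qed

text \<open>Two applications of \<open>betti_le\<close>, in opposite directions, show that the
  definite description has exactly one solution.\<close>

lemma graded_betti_eq:
  assumes "minimal_resolution V I r d A \<epsilon>"
  shows "graded_betti V I i j = card {b. b < r i \<and> d i b = j}"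
proof -
  interpret F: minimal_resolution V I r d A \<epsilon> by fact
  note iff = minimal_graded_free_resolution_iff[OF F.ideal]
  show ?thesis
    unfolding graded_betti_def
  proof (rule the_equality)
    show "\<exists>r' d' A' \<epsilon>'. minimal_graded_free_resolution V I r' d' A' \<epsilon>' \<and>
        card {b. b < r i \<and> d i b = j} = card {b. b < r' i \<and> d' i b = j}"
      by (intro exI conjI) (rule iff[THEN iffD2, OF assms], rule refl)
    fix c assume "\<exists>r' d' A' \<epsilon>'. minimal_graded_free_resolution V I r' d' A' \<epsilon>' \<and> c = card {b. b < r' i \<and> d' i b = j}"
    then obtain r' d' A' \<epsilon>' where M: "minimal_graded_free_resolution V I r' d' A' \<epsilon>'"
      and c: "c = card {b. b < r' i \<and> d' i b = j}"
      by (elim exE conjE)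
    interpret G: minimal_resolution V I r' d' A' \<epsilon>' by (rule iff[THEN iffD1, OF M])
    show "c = card {b. b < r i \<and> d i b = j}"
      using F.betti_le[OF G.graded_resolution_axioms, of i j] G.betti_le[OF F.graded_resolution_axioms, of i j] c
      by simp
  qed
qed

section \<open>Mapping cones\<close>

text \<open>Free of the zero padding of \<open>mat_apply\<close>: composition becomes an equation of
  functions, and index shifts in block matrices need no case distinction on the number of
  rows.\<close>

definition mat_vec :: "nat \<Rightarrow> (nat \<Rightarrow> nat \<Rightarrow> 'a::comm_ring_1) \<Rightarrow> (nat \<Rightarrow> 'a) \<Rightarrow> nat \<Rightarrow> 'a" where
  "mat_vec r A f = (\<lambda>a. \<Sum>b<r. A a b * f b)"

lemma mat_apply_mat_vec: "mat_apply s r A f = (\<lambda>a. if a < s then mat_vec r A f a else 0)"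
  by (rule ext) (simp add: mat_apply_def mat_vec_def)

lemma mat_vec_mprod: "mat_vec q (mat_prod r A B) f = mat_vec r A (mat_vec q B f)"
proof
  fix a
  show "mat_vec q (mat_prod r A B) f a = mat_vec r A (mat_vec q B f) a"
    unfolding mat_vec_def mat_prod_def sum_distrib_left sum_distrib_right
    by (subst sum.swap) (simp add: mult.assoc)
qed

lemma mat_vec_cong:
  assumes "\<And>b. b < r \<Longrightarrow> A a b = A' a' b" "\<And>b. b < r \<Longrightarrow> f b = f' b"
  shows "mat_vec r A f a = mat_vec r A' f' a'"
  unfolding mat_vec_def using assms by (intro sum.cong) auto

lemma mat_vec_add: "mat_vec r A (\<lambda>b. f b + g b) a = mat_vec r A f a + mat_vec r A g a"
  by (simp add: mat_vec_def distrib_left sum.distrib)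

lemma mat_vec_uminus: "mat_vec r A (\<lambda>b. - f b) a = - mat_vec r A f a"
  by (simp add: mat_vec_def sum_negf)

lemma mat_vec_in_poly_ring:
  assumes "\<And>b. b < r \<Longrightarrow> A a b \<in> poly_ring V" "\<And>b. b < r \<Longrightarrow> f b \<in> poly_ring V"
  shows "mat_vec r A f a \<in> poly_ring V"
  unfolding mat_vec_def using assms by (intro poly_ring_sum poly_ring_mult) auto

lemma sum_lessThan_add: "(\<Sum>b<p + q. h b) = (\<Sum>b<p. h b) + (\<Sum>b<q. h (p + b) :: 'a::comm_monoid_add)" for p q :: nat
  by (induction q) (simp_all add: add.assoc)

context graded_resolution
begin

lemma syzygies_Suc_iff:
  "f \<in> Z (Suc i) \<longleftrightarrow> f \<in> free_module V (r (Suc i)) \<and> (\<forall>a<r i. mat_vec (r (Suc i)) (A i) f a = 0)"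
  by (auto simp: syzygies_def mat_apply_mat_vec fun_eq_iff)

lemma syzygies_lift:
  assumes "f \<in> Z i"
  obtains z where "z \<in> free_module V (r (Suc i))" "\<And>a. a < r i \<Longrightarrow> f a = mat_vec (r (Suc i)) (A i) z a"
proof -
  obtain z where z: "z \<in> free_module V (r (Suc i))" "f = mat_apply (r i) (r (Suc i)) (A i) z"
    using assms unfolding exact by blast
  then show ?thesis by (intro that[of z]) (simp_all add: mat_apply_mat_vec)
qed

lemma mat_vec_square:
  assumes "a < r i"
  shows "mat_vec (r (Suc i)) (A i) (mat_vec (r (Suc (Suc i))) (A (Suc i)) z) a = 0"
  unfolding mat_vec_mprod[symmetric] unfolding mat_vec_def
  using differential_square[OF assms] by simp

end

text \<open>Every resolution built here starts with \<open>R\<close> itself and has all generators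
  of its \<open>i\<close>-th module in the single degree \<open>\<delta> i\<close>. Exactness is
  split into its two inclusions, at index 0 and at later indices, and stated row by row.\<close>

lemma cyclic_resolutionI:
  assumes I: "homogeneous_ideal V I" and r0: "r 0 = 1" and \<delta>0: "\<delta> 0 = 0"
    and graded_mat: "\<And>i. graded_mat V (r i) (\<lambda>_. \<delta> i) (r (Suc i)) (\<lambda>_. \<delta> (Suc i)) (A i)"
    and ex0: "\<And>p. p \<in> I \<Longrightarrow> p \<in> poly_ring V \<Longrightarrow> \<exists>z\<in>free_module V (r 1). p = mat_vec (r 1) (A 0) z 0"
    and im0: "\<And>z. z \<in> free_module V (r 1) \<Longrightarrow> mat_vec (r 1) (A 0) z 0 \<in> I"
    and exS: "\<And>i f. f \<in> free_module V (r (Suc i)) \<Longrightarrow> (\<And>a. a < r i \<Longrightarrow> mat_vec (r (Suc i)) (A i) f a = 0) \<Longrightarrow>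
      \<exists>z\<in>free_module V (r (Suc (Suc i))). \<forall>a<r (Suc i). f a = mat_vec (r (Suc (Suc i))) (A (Suc i)) z a"
    and imS: "\<And>i z a. z \<in> free_module V (r (Suc (Suc i))) \<Longrightarrow> a < r i \<Longrightarrow>
      mat_vec (r (Suc i)) (A i) (mat_vec (r (Suc (Suc i))) (A (Suc i)) z) a = 0"
  shows "graded_resolution V I r (\<lambda>i _. \<delta> i) A (\<lambda>_. 1)"
proof unfold_locales
  fix p :: "'a mpoly" assume p: "p \<in> poly_ring V"
  have "0 \<in> I" using I by (simp add: homogeneous_ideal_def)
  then show "\<exists>f\<in>free_module V (r 0). p - (\<Sum>a<r 0. f a * 1) \<in> I"
    using p r0 by (intro bexI[of _ "\<lambda>a. if a = 0 then p else 0"]) (auto simp: free_module_def)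
next
  fix i
  have im_free: "mat_apply (r i) (r (Suc i)) (A i) z \<in> free_module V (r i)" if "z \<in> free_module V (r (Suc i))" for z
    using that graded_mat[of i] by (auto simp: mat_apply_mat_vec free_module_def graded_mat_def intro!: mat_vec_in_poly_ring)
  show "syzygies V I r A (\<lambda>_. 1) i = mat_apply (r i) (r (Suc i)) (A i) ` free_module V (r (Suc i))"
  proof (intro equalityI subsetI)
    fix f assume f: "f \<in> syzygies V I r A (\<lambda>_. 1) i"
    then have free: "f \<in> free_module V (r i)"
      by (auto simp: syzygies_def split: nat.splits)
    have "\<exists>z\<in>free_module V (r (Suc i)). \<forall>a<r i. f a = mat_vec (r (Suc i)) (A i) z a"
    proof (cases i)
      case 0
      then have "f 0 \<in> I" "f 0 \<in> poly_ring V"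
        using f free r0 by (auto simp: syzygies_def free_module_def)
      from ex0[OF this] show ?thesis using 0 r0 by simp
    next
      case (Suc j)
      then have "mat_apply (r j) (r (Suc j)) (A j) f = (\<lambda>_. 0)"
        using f by (simp add: syzygies_def)
      then have "\<And>a. a < r j \<Longrightarrow> mat_vec (r (Suc j)) (A j) f a = 0"
        unfolding mat_apply_mat_vec by (metis (full_types))
      with exS[of f j] free Suc show ?thesis by simp
    qed
    then obtain z where z: "z \<in> free_module V (r (Suc i))" "\<forall>a<r i. f a = mat_vec (r (Suc i)) (A i) z a"
      by blast
    have "f = mat_apply (r i) (r (Suc i)) (A i) z"
      using z(2) free by (auto simp: mat_apply_mat_vec free_module_def fun_eq_iff)
    then show "f \<in> mat_apply (r i) (r (Suc i)) (A i) ` free_module V (r (Suc i))"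
      using z(1) by blast
  next
    fix f assume "f \<in> mat_apply (r i) (r (Suc i)) (A i) ` free_module V (r (Suc i))"
    then obtain z where z: "z \<in> free_module V (r (Suc i))" "f = mat_apply (r i) (r (Suc i)) (A i) z"
      by blast
    show "f \<in> syzygies V I r A (\<lambda>_. 1) i"
    proof (cases i)
      case 0
      then show ?thesis using z im_free[OF z(1)] im0[of z] r0
        by (simp add: syzygies_def mat_apply_mat_vec)
    next
      case (Suc j)
      have "mat_vec (r (Suc j)) (A j) f a = 0" if "a < r j" for a
      proof -
        have "mat_vec (r (Suc j)) (A j) f a = mat_vec (r (Suc j)) (A j) (mat_vec (r (Suc (Suc j))) (A (Suc j)) z) a"
          by (rule mat_vec_cong) (simp_all add: z(2) Suc mat_apply_mat_vec)
        then show ?thesis using imS[of z j a] z(1) Suc that by simp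
      qed
      then have "mat_apply (r j) (r (Suc j)) (A j) f = (\<lambda>_. 0)"
        by (simp add: mat_apply_mat_vec fun_eq_iff)
      moreover have "f \<in> free_module V (r i)" using im_free[OF z(1)] z(2) by simp
      ultimately show ?thesis using Suc by (simp add: syzygies_def)
    qed
  qed
qed (use assms in auto)

lemma homogeneous_ideal_zero: "homogeneous_ideal V (mono_ideal V {} :: 'k::field mpoly set)"
  by (rule homogeneous_ideal_mono_ideal) simp

text \<open>The start of every iterated cone. Beyond index 0 there are no generators, so
  \<open>\<delta>\<close> may follow either of the two shift patterns used later.\<close>

lemma resolution_zero_ideal:
  assumes "\<delta> 0 = 0"
  shows "graded_resolution V (mono_ideal V {} :: 'k::field mpoly set) (\<lambda>i. if i = 0 then 1 else 0) (\<lambda>i _. \<delta> i) (\<lambda>_ _ _. 0) (\<lambda>_. 1)"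
proof (rule cyclic_resolutionI)
  have keys_empty: "Poly_Mapping.keys p = {} \<Longrightarrow> p = 0" for p :: "'k mpoly"
    by (rule poly_mapping_eqI) (metis empty_iff in_keys_iff lookup_zero)
  fix p :: "'k mpoly" assume "p \<in> mono_ideal V {}"
  then have "p = 0" using keys_empty by (simp add: mono_ideal_def)
  then show "\<exists>z\<in>free_module V (if (1::nat) = 0 then 1 else 0). p = mat_vec (if (1::nat) = 0 then 1 else 0) (\<lambda>_ _. 0) z 0"
    by (intro bexI[of _ "\<lambda>_. 0"]) (simp_all add: mat_vec_def free_module_def)
qed (use assms homogeneous_ideal_zero in \<open>auto simp: graded_mat_def mat_vec_def free_module_def mono_ideal_def\<close>)

section \<open>The cone of a chain map, in block form\<close>

definition cone_rank :: "(nat \<Rightarrow> nat) \<Rightarrow> (nat \<Rightarrow> nat) \<Rightarrow> nat \<Rightarrow> nat" where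
  "cone_rank p q i = p i + (case i of 0 \<Rightarrow> 0 | Suc j \<Rightarrow> q j)"

lemma cone_rank_simps [simp]: "cone_rank p q 0 = p 0" "cone_rank p q (Suc i) = p (Suc i) + q i"
  by (simp_all add: cone_rank_def)

text \<open>The mapping cone of \<open>\<phi> : G \<rightarrow> F\<close>: in \<open>F\<^sub>i \<oplus> G\<^sub>i\<^sub>-\<^sub>1\<close> the basis of \<open>F\<^sub>i\<close> comes first.  The
  junk value \<open>B (0 - 1)\<close> is never used, since \<open>G\<^sub>-\<^sub>1 = 0\<close>.\<close>

definition cone_matrix :: "(nat \<Rightarrow> nat) \<Rightarrow> (nat \<Rightarrow> nat \<Rightarrow> nat \<Rightarrow> 'a::comm_ring_1) \<Rightarrow> (nat \<Rightarrow> nat \<Rightarrow> nat \<Rightarrow> 'a) \<Rightarrow>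
    (nat \<Rightarrow> nat \<Rightarrow> nat \<Rightarrow> 'a) \<Rightarrow> nat \<Rightarrow> nat \<Rightarrow> nat \<Rightarrow> 'a" where
  "cone_matrix p A B \<phi> i a b =
    (if a < p i then (if b < p (Suc i) then A i a b else \<phi> i a (b - p (Suc i)))
     else (if b < p (Suc i) then 0 else - B (i - 1) (a - p i) (b - p (Suc i))))"

lemma mat_vec_cone_upper:
  assumes "a < p i"
  shows "mat_vec (p (Suc i) + q) (cone_matrix p A B \<phi> i) f a =
    mat_vec (p (Suc i)) (A i) f a + mat_vec q (\<phi> i) (\<lambda>b. f (p (Suc i) + b)) a"
  using assms by (simp add: mat_vec_def sum_lessThan_add cone_matrix_def)

lemma mat_vec_cone_lower:
  "mat_vec (p (Suc (Suc i)) + q) (cone_matrix p A B \<phi> (Suc i)) f (p (Suc i) + a) =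
    - mat_vec q (B i) (\<lambda>b. f (p (Suc (Suc i)) + b)) a"
  by (simp add: mat_vec_def sum_lessThan_add cone_matrix_def sum_negf)

text \<open>This identifies the colon ideal by a monomial on the level of exponents.\<close>

lemma single_mult_in_mono_ideal:
  assumes "Poly_Mapping.keys a \<subseteq> V" "y \<in> poly_ring V"
  shows "Poly_Mapping.single a 1 * y \<in> (mono_ideal V M :: 'k::field mpoly set) \<longleftrightarrow> y \<in> mono_ideal V {m. a + m \<in> M}"
  using assms by (auto simp: mono_ideal_def keys_single_mult)

text \<open>The terms of \<open>p\<close> with exponent outside \<open>M\<close> are all divisible
  by the new monomial; \<open>y\<close> is their termwise quotient, where the truncated
  \<open>m - a\<close> is exact.\<close>

lemma mono_ideal_insert_generator:
  assumes M: "p \<in> mono_ideal V (M \<union> range ((+) a))"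
  obtains u y where "u \<in> (mono_ideal V M :: 'k::field mpoly set)" "y \<in> poly_ring V" "p = u + Poly_Mapping.single a 1 * y"
proof -
  define u where "u = filter_terms (\<lambda>m. m \<in> M) p"
  define v where "v = filter_terms (\<lambda>m. m \<notin> M) p"
  define y where "y = (\<Sum>m\<in>Poly_Mapping.keys v. Poly_Mapping.single (m - a) (Poly_Mapping.lookup v m))"
  have p: "p \<in> poly_ring V" "Poly_Mapping.keys p \<subseteq> M \<union> range ((+) a)"
    using M by (auto simp: mono_ideal_def)
  have sub: "\<exists>m'. m = a + m'" if "m \<in> Poly_Mapping.keys v" for m
    using that p by (auto simp: v_def keys_filter_terms)
  have "Poly_Mapping.single a 1 * y = (\<Sum>m\<in>Poly_Mapping.keys v. Poly_Mapping.single m (Poly_Mapping.lookup v m))"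
    unfolding y_def sum_distrib_left mult_single by (intro sum.cong) (use sub in \<open>force+\<close>)
  also have "\<dots> = v"
    by (rule sum_singles[symmetric])
  finally have v: "Poly_Mapping.single a 1 * y = v" .
  have "y \<in> poly_ring V"
    unfolding y_def
  proof (intro poly_ring_sum poly_ring_single)
    fix m assume m: "m \<in> Poly_Mapping.keys v"
    then obtain m' where "m = a + m'" using sub by blast
    moreover have "Poly_Mapping.keys m \<subseteq> V"
      using m p(1) by (auto simp: v_def keys_filter_terms poly_ring_def)
    ultimately show "Poly_Mapping.keys (m - a) \<subseteq> V" by (simp add: keys_add_monomial)
  qed
  moreover have "u \<in> mono_ideal V M"
    using p by (auto simp: u_def mono_ideal_def keys_filter_terms)
  moreover have "p = u + Poly_Mapping.single a 1 * y"
    unfolding v u_def v_def by (simp add: filter_terms_decomp)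
  ultimately show ?thesis using that by blast
qed

text \<open>Multiplication by the monomial \<open>x\<^sup>a\<close> embeds \<open>R/(I : x\<^sup>a)\<close>, shifted, into \<open>R/I\<close> with
  cokernel \<open>R/(I + x\<^sup>a R)\<close>; the cone of a lift to resolutions resolves this cokernel.\<close>

lemma mapping_cone_resolution:
  fixes A B :: "nat \<Rightarrow> nat \<Rightarrow> nat \<Rightarrow> 'k::field mpoly"
  assumes F: "graded_resolution V (mono_ideal V M) p (\<lambda>i _. \<delta> i) A (\<lambda>_. 1)"
    and G: "graded_resolution V (mono_ideal V {m. a + m \<in> M}) q (\<lambda>i _. \<gamma> i) B (\<lambda>_. 1)"
    and p0: "p 0 = 1" and q0: "q 0 = 1" and \<delta>0: "\<delta> 0 = 0" and \<gamma>0: "\<gamma> 0 = 0"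
    and aV: "Poly_Mapping.keys a \<subseteq> V"
    and shift: "\<And>i. \<gamma> i + mdeg a = \<delta> (Suc i)"
    and up: "\<And>m m'. m \<in> M \<Longrightarrow> m' + m \<in> M"
  obtains C where "graded_resolution V (mono_ideal V (M \<union> range ((+) a))) (cone_rank p q) (\<lambda>i _. \<delta> i) C (\<lambda>_. 1 :: 'k mpoly)"
proof -
  interpret F: graded_resolution V "mono_ideal V M" p "\<lambda>i _. \<delta> i" A "\<lambda>_. 1" by fact
  interpret G: graded_resolution V "mono_ideal V {m. a + m \<in> M}" q "\<lambda>i _. \<gamma> i" B "\<lambda>_. 1" by fact
  let ?x = "Poly_Mapping.single a 1 :: 'k mpoly"
  have x_ring: "?x \<in> poly_ring V" using aV by (rule poly_ring_single)
  \<comment> \<open>Shifting all degrees of the second resolution by \<open>mdeg a\<close> makes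
    multiplication by the monomial a map of degree 0.\<close>
  have Bdeg: "graded_mat V (q i) (\<lambda>_. \<gamma> i + mdeg a) (q (Suc i)) (\<lambda>_. \<gamma> (Suc i) + mdeg a) (B i)" for i
    using G.graded_mat[of i] by (simp add: graded_mat_def algebra_simps)
  have x_gmat: "graded_mat V (p 0) (\<lambda>_. \<delta> 0) (q 0) (\<lambda>_. \<gamma> 0 + mdeg a) (\<lambda>_ _. ?x)"
    using x_ring \<delta>0 \<gamma>0 by (simp add: graded_mat_def)
  \<comment> \<open>The generators of the colon ideal are carried into the old ideal; this is the
    condition under which multiplication extends to a chain map.\<close>
  have x_kern: "mat_col (p 0) (mat_prod (q 0) (\<lambda>_ _. ?x) (B 0)) b \<in> F.Z 0" if b: "b < q 1" for b
  proof -
    have "B 0 0 b \<in> mono_ideal V {m. a + m \<in> M}"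
      using G.column_in_syzygies[of b 0] b unfolding G.mat_col_in_syzygies_0 by (simp add: q0)
    moreover have "B 0 0 b \<in> poly_ring V" using G.A_in_poly_ring[of 0 0 b] b q0 by simp
    ultimately have "?x * B 0 0 b \<in> mono_ideal V M"
      by (simp add: single_mult_in_mono_ideal[OF aV])
    then show ?thesis
      unfolding F.mat_col_in_syzygies_0 by (simp add: p0 q0 mat_prod_def) (simp add: mono_ideal_def)
  qed
  have "\<exists>\<phi>. (\<forall>i. graded_mat V (p i) (\<lambda>_. \<delta> i) (q i) (\<lambda>_. \<gamma> i + mdeg a) (\<phi> i)) \<and> \<phi> 0 = (\<lambda>_ _. ?x) \<and>
    (\<forall>i. \<forall>a<p i. \<forall>b<q (Suc i).
      mat_prod (q i) (\<phi> i) (B i) a b = mat_prod (p (Suc i)) (A i) (\<phi> (Suc i)) a b)"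
    by (rule F.comparison) (fact Bdeg G.differential_square x_gmat x_kern)+
  then obtain \<phi> where \<phi>: "\<And>i. graded_mat V (p i) (\<lambda>_. \<delta> i) (q i) (\<lambda>_. \<gamma> i + mdeg a) (\<phi> i)"
    and \<phi>0: "\<phi> 0 = (\<lambda>_ _. ?x)"
    and comm: "\<And>i a b. a < p i \<Longrightarrow> b < q (Suc i) \<Longrightarrow>
      mat_prod (q i) (\<phi> i) (B i) a b = mat_prod (p (Suc i)) (A i) (\<phi> (Suc i)) a b"
    by blast
  have comm_mv: "mat_vec (q i) (\<phi> i) (mat_vec (q (Suc i)) (B i) z) c = mat_vec (p (Suc i)) (A i) (mat_vec (q (Suc i)) (\<phi> (Suc i)) z) c"
    if "c < p i" for i z c
    unfolding mat_vec_mprod[symmetric] by (rule mat_vec_cong) (use comm that in auto)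
  have \<phi>_ring: "c < p i \<Longrightarrow> b < q i \<Longrightarrow> \<phi> i c b \<in> poly_ring V" for i c b
    using \<phi>[of i] by (simp add: graded_mat_def)
  let ?R = "cone_rank p q" and ?D = "cone_matrix p A B \<phi>"
  let ?I = "mono_ideal V (M \<union> range ((+) a)) :: 'k mpoly set"
  have "graded_resolution V ?I ?R (\<lambda>i _. \<delta> i) ?D (\<lambda>_. 1)"
  proof (rule cyclic_resolutionI)
    show "homogeneous_ideal V ?I"
    proof (rule homogeneous_ideal_mono_ideal)
      fix m m' assume "m \<in> M \<union> range ((+) a)"
      then show "m' + m \<in> M \<union> range ((+) a)"
        using up by (auto simp: add.left_commute)
    qed
    show "graded_mat V (?R i) (\<lambda>_. \<delta> i) (?R (Suc i)) (\<lambda>_. \<delta> (Suc i)) (?D i)" for i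
      unfolding graded_mat_def
    proof (intro allI impI)
      fix c b assume c: "c < ?R i" and b: "b < ?R (Suc i)"
      let ?ok = "\<lambda>x. x \<in> poly_ring V \<and> (\<forall>m\<in>Poly_Mapping.keys x. mdeg m + \<delta> i = \<delta> (Suc i))"
      consider "c < p i" "b < p (Suc i)" | "c < p i" "\<not> b < p (Suc i)" | "\<not> c < p i" "b < p (Suc i)"
        | "\<not> c < p i" "\<not> b < p (Suc i)" by blast
      then show "?ok (?D i c b)"
      proof cases
        case 1
        then show ?thesis using F.graded_mat[of i] by (simp add: cone_matrix_def graded_mat_def)
      next
        case 2
        moreover define b' where "b' = b - p (Suc i)"
        ultimately have "b' < q i" "?D i c b = \<phi> i c b'"
          using b by (auto simp: cone_matrix_def)
        then show ?thesis using \<phi>[of i] 2 unfolding graded_mat_def shift by metis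
      next
        case 3
        then show ?thesis by (simp add: cone_matrix_def)
      next
        case 4
        then obtain j where j: "i = Suc j" using c by (cases i) auto
        define c' b' where "c' = c - p i" and "b' = b - p (Suc i)"
        have "c' < q j" "b' < q (Suc j)" using 4 c b j by (auto simp: c'_def b'_def)
        then have *: "B j c' b' \<in> poly_ring V" "\<And>m. m \<in> Poly_Mapping.keys (B j c' b') \<Longrightarrow> mdeg m + \<gamma> j = \<gamma> i"
          using G.graded_mat[of j] j by (simp_all add: graded_mat_def)
        have "?D i c b = - B j c' b'"
          using 4 j by (simp add: cone_matrix_def c'_def b'_def)
        moreover have "?ok (- B j c' b')"
        proof (intro conjI ballI)
          show "- B j c' b' \<in> poly_ring V" using *(1) by (rule poly_ring_uminus)
          fix m assume "m \<in> Poly_Mapping.keys (- B j c' b')"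
          then have "mdeg m + \<gamma> j = \<gamma> i" using *(2) by (simp add: in_keys_iff)
          then show "mdeg m + \<delta> i = \<delta> (Suc i)"
            unfolding shift[symmetric] j using j shift[of j] by simp
        qed
        ultimately show ?thesis by simp
      qed
    qed
    show "\<exists>z\<in>free_module V (?R 1). f = mat_vec (?R 1) (?D 0) z 0" if f: "f \<in> ?I" for f
    proof -
      obtain u y where u: "u \<in> mono_ideal V M" and y: "y \<in> poly_ring V" and f_eq: "f = u + ?x * y"
        using mono_ideal_insert_generator[OF f] by blast
      have "(\<lambda>c. if c = 0 then u else 0) \<in> F.Z 0"
        using u by (auto simp: syzygies_def p0 free_module_def mono_ideal_def)
      then obtain z where z1: "z \<in> free_module V (p (Suc 0))"
        and "\<And>c. c < p 0 \<Longrightarrow> (if c = 0 then u else 0) = mat_vec (p (Suc 0)) (A 0) z c"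
        by (rule F.syzygies_lift) blast
      from this(2)[of 0] have z2: "u = mat_vec (p (Suc 0)) (A 0) z 0" by (simp add: p0)
      define g where "g = (\<lambda>b. if b < p (Suc 0) then z b else if b = p (Suc 0) then y else 0)"
      have "mat_vec (?R 1) (?D 0) g 0 = mat_vec (p (Suc 0)) (A 0) g 0 + mat_vec (q 0) (\<phi> 0) (\<lambda>b. g (p (Suc 0) + b)) 0"
        using mat_vec_cone_upper[of 0 p 0] p0 by simp
      also have "mat_vec (p (Suc 0)) (A 0) g 0 = u"
        unfolding z2 by (rule mat_vec_cong) (simp_all add: g_def)
      also have "mat_vec (q 0) (\<phi> 0) (\<lambda>b. g (p (Suc 0) + b)) 0 = ?x * y"
        by (simp add: q0 \<phi>0 mat_vec_def g_def)
      finally have "f = mat_vec (?R 1) (?D 0) g 0" using f_eq by simp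
      moreover have "g \<in> free_module V (?R 1)"
        using z1 y by (auto simp: g_def free_module_def q0)
      ultimately show ?thesis by blast
    qed
    show "mat_vec (?R 1) (?D 0) z 0 \<in> ?I" if z: "z \<in> free_module V (?R 1)" for z
    proof -
      have zr: "b < p (Suc 0) + 1 \<Longrightarrow> z b \<in> poly_ring V" for b
        using z q0 by (simp add: free_module_def)
      have "(\<lambda>b. if b < p (Suc 0) then z b else 0) \<in> free_module V (p (Suc 0))"
        using zr by (simp add: free_module_def)
      then have "mat_apply (p 0) (p (Suc 0)) (A 0) (\<lambda>b. if b < p (Suc 0) then z b else 0) \<in> F.Z 0"
        unfolding F.exact by blast
      then have "mat_vec (p (Suc 0)) (A 0) (\<lambda>b. if b < p (Suc 0) then z b else 0) 0 \<in> mono_ideal V M"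
        by (simp add: syzygies_def mat_apply_mat_vec p0)
      also have "mat_vec (p (Suc 0)) (A 0) (\<lambda>b. if b < p (Suc 0) then z b else 0) 0 = mat_vec (p (Suc 0)) (A 0) z 0"
        by (rule mat_vec_cong) auto
      finally have 1: "mat_vec (p (Suc 0)) (A 0) z 0 \<in> mono_ideal V M" .
      have 2: "mat_vec (?R 1) (?D 0) z 0 = mat_vec (p (Suc 0)) (A 0) z 0 + ?x * z (p (Suc 0))"
        using mat_vec_cone_upper[of 0 p 0 1 A B \<phi> z] p0 by (simp add: q0 \<phi>0) (simp add: mat_vec_def)
      have 3: "?x * z (p (Suc 0)) \<in> poly_ring V" using x_ring zr by auto
      show ?thesis
        using 1 3 keys_add[of "mat_vec (p (Suc 0)) (A 0) z 0" "?x * z (p (Suc 0))"]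
        unfolding 2 by (auto simp: mono_ideal_def keys_single_mult)
    qed
    show "\<exists>z\<in>free_module V (?R (Suc (Suc i))). \<forall>a<?R (Suc i). f a = mat_vec (?R (Suc (Suc i))) (?D (Suc i)) z a"
      if f: "f \<in> free_module V (?R (Suc i))" and f0: "\<And>a. a < ?R i \<Longrightarrow> mat_vec (?R (Suc i)) (?D i) f a = 0" for i f
    proof -
      \<comment> \<open>Components of the cycle \<open>f\<close> in the two blocks. First
        \<open>y\<close> is lifted to \<open>z\<close>; adding the image of \<open>z\<close> under
        \<open>\<phi>\<close> then turns \<open>x\<close> into a cycle of the first resolution,
        which is lifted in turn.\<close>
      define x where "x = (\<lambda>b. if b < p (Suc i) then f b else 0)"
      define y where "y = (\<lambda>b. if b < q i then f (p (Suc i) + b) else 0)"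
      have x_free: "x \<in> free_module V (p (Suc i))" and y_free: "y \<in> free_module V (q i)"
        using f by (auto simp: x_def y_def free_module_def)
      have upper: "mat_vec (p (Suc i)) (A i) x c + mat_vec (q i) (\<phi> i) y c = 0" if "c < p i" for c
      proof -
        have "mat_vec (p (Suc i)) (A i) x c = mat_vec (p (Suc i)) (A i) f c"
          by (rule mat_vec_cong) (auto simp: x_def)
        moreover have "mat_vec (q i) (\<phi> i) y c = mat_vec (q i) (\<phi> i) (\<lambda>b. f (p (Suc i) + b)) c"
          by (rule mat_vec_cong) (auto simp: y_def)
        ultimately show ?thesis
          using f0[of c] that mat_vec_cone_upper[of c p i "q i" A B \<phi> f] by (simp add: cone_rank_def)
      qed
      \<comment> \<open>At index 0 this is the colon property: the monomial times \<open>y 0\<close>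
        lies in the old ideal. At later indices it is read off from the lower block of the
        cone.\<close>
      have "y \<in> G.Z i"
      proof (cases i)
        case 0
        have "- mat_vec (p (Suc 0)) (A 0) x 0 \<in> mono_ideal V M"
        proof -
          have "mat_apply (p 0) (p (Suc 0)) (A 0) x \<in> F.Z 0"
            unfolding F.exact using x_free 0 by blast
          then have "mat_vec (p (Suc 0)) (A 0) x 0 \<in> mono_ideal V M"
            by (simp add: syzygies_def mat_apply_mat_vec p0)
          from F.ideal_minus[OF F.ideal_zero this] show ?thesis by simp
        qed
        moreover have "?x * y 0 = - mat_vec (p (Suc 0)) (A 0) x 0"
          using upper[of 0] 0 p0 by (simp add: \<phi>0 q0 mat_vec_def add_eq_0_iff)
        ultimately have "?x * y 0 \<in> mono_ideal V M" by simp
        moreover have "y 0 \<in> poly_ring V" using y_free q0 0 by (simp add: free_module_def)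
        ultimately have "y 0 \<in> mono_ideal V {m. a + m \<in> M}"
          by (simp add: single_mult_in_mono_ideal[OF aV])
        then show ?thesis using y_free 0 by (simp add: syzygies_def q0)
      next
        case (Suc j)
        have "mat_vec (q (Suc j)) (B j) y c = 0" if "c < q j" for c
        proof -
          have "mat_vec (q (Suc j)) (B j) y c = mat_vec (q (Suc j)) (B j) (\<lambda>b. f (p (Suc (Suc j)) + b)) c"
            by (rule mat_vec_cong) (auto simp: y_def Suc)
          also have "\<dots> = - mat_vec (?R (Suc i)) (?D i) f (p (Suc j) + c)"
            using mat_vec_cone_lower[of p j "q (Suc j)" A B \<phi> f c] Suc by simp
          also have "\<dots> = 0" using f0[of "p (Suc j) + c"] that Suc by simp
          finally show ?thesis .
        qed
        then show ?thesis using y_free Suc by (simp add: G.syzygies_Suc_iff)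
      qed
      then obtain z where z: "z \<in> free_module V (q (Suc i))" and y_eq: "\<And>c. c < q i \<Longrightarrow> y c = mat_vec (q (Suc i)) (B i) z c"
        by (rule G.syzygies_lift) (rule that)
      define x' where "x' = (\<lambda>c. if c < p (Suc i) then x c + mat_vec (q (Suc i)) (\<phi> (Suc i)) z c else 0)"
      have "x' \<in> F.Z (Suc i)"
        unfolding F.syzygies_Suc_iff
      proof (intro conjI allI impI)
        show "x' \<in> free_module V (p (Suc i))"
          using x_free z \<phi>_ring[of _ "Suc i"]
          by (auto simp: x'_def free_module_def intro!: mat_vec_in_poly_ring poly_ring_add)
        fix c assume c: "c < p i"
        have "mat_vec (p (Suc i)) (A i) x' c = mat_vec (p (Suc i)) (A i) (\<lambda>c. x c + mat_vec (q (Suc i)) (\<phi> (Suc i)) z c) c"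
          by (rule mat_vec_cong) (auto simp: x'_def)
        also have "\<dots> = mat_vec (p (Suc i)) (A i) x c + mat_vec (q i) (\<phi> i) (mat_vec (q (Suc i)) (B i) z) c"
          using comm_mv[OF c, of z] by (simp add: mat_vec_add)
        also have "mat_vec (q i) (\<phi> i) (mat_vec (q (Suc i)) (B i) z) c = mat_vec (q i) (\<phi> i) y c"
          by (rule mat_vec_cong) (simp_all add: y_eq)
        finally show "mat_vec (p (Suc i)) (A i) x' c = 0" using upper[OF c] by simp
      qed
      then obtain w where w: "w \<in> free_module V (p (Suc (Suc i)))"
        and x'_eq: "\<And>c. c < p (Suc i) \<Longrightarrow> x' c = mat_vec (p (Suc (Suc i))) (A (Suc i)) w c"
        by (rule F.syzygies_lift) (rule that)
      \<comment> \<open>The sign at \<open>z\<close> compensates the one of the lower block, and it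
        removes the image of \<open>z\<close> that was added to \<open>x\<close>.\<close>
      define g where "g = (\<lambda>b. if b < p (Suc (Suc i)) then w b else - z (b - p (Suc (Suc i))))"
      have "g \<in> free_module V (?R (Suc (Suc i)))"
        using w z by (auto simp: g_def free_module_def)
      moreover have "f c = mat_vec (?R (Suc (Suc i))) (?D (Suc i)) g c" if c: "c < ?R (Suc i)" for c
      proof (cases "c < p (Suc i)")
        case True
        have "mat_vec (?R (Suc (Suc i))) (?D (Suc i)) g c =
          mat_vec (p (Suc (Suc i))) (A (Suc i)) g c + mat_vec (q (Suc i)) (\<phi> (Suc i)) (\<lambda>b. g (p (Suc (Suc i)) + b)) c"
          using mat_vec_cone_upper[of c p "Suc i"] True by simp
        also have "mat_vec (p (Suc (Suc i))) (A (Suc i)) g c = x' c"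
          unfolding x'_eq[OF True] by (rule mat_vec_cong) (auto simp: g_def)
        also have "mat_vec (q (Suc i)) (\<phi> (Suc i)) (\<lambda>b. g (p (Suc (Suc i)) + b)) c = - mat_vec (q (Suc i)) (\<phi> (Suc i)) z c"
          by (simp add: g_def mat_vec_uminus)
        finally show ?thesis using True by (simp add: x'_def x_def)
      next
        case False
        then obtain c' where c': "c = p (Suc i) + c'" "c' < q i"
          using c le_Suc_ex[of "p (Suc i)" c] by auto
        have "mat_vec (?R (Suc (Suc i))) (?D (Suc i)) g c = - mat_vec (q (Suc i)) (B i) (\<lambda>b. g (p (Suc (Suc i)) + b)) c'"
          using mat_vec_cone_lower[of p i "q (Suc i)"] c' by simp
        also have "\<dots> = mat_vec (q (Suc i)) (B i) z c'"
          by (simp add: g_def mat_vec_uminus)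
        also have "\<dots> = f c" using y_eq[OF c'(2)] c' by (simp add: y_def)
        finally show ?thesis by simp
      qed
      ultimately show ?thesis by blast
    qed
    show "mat_vec (?R (Suc i)) (?D i) (mat_vec (?R (Suc (Suc i))) (?D (Suc i)) z) c = 0"
      if "z \<in> free_module V (?R (Suc (Suc i)))" and c: "c < ?R i" for i z c
    proof -
      define y where "y = (\<lambda>b. z (p (Suc (Suc i)) + b))"
      let ?f = "mat_vec (?R (Suc (Suc i))) (?D (Suc i)) z"
      have up: "?f b = mat_vec (p (Suc (Suc i))) (A (Suc i)) z b + mat_vec (q (Suc i)) (\<phi> (Suc i)) y b" if "b < p (Suc i)" for b
        using mat_vec_cone_upper[of b p "Suc i"] that by (simp add: y_def)
      have low: "?f (p (Suc i) + b) = - mat_vec (q (Suc i)) (B i) y b" for b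
        by (simp add: mat_vec_cone_lower y_def)
      show ?thesis
      proof (cases "c < p i")
        case True
        \<comment> \<open>The mixed terms cancel: \<open>\<phi>\<close> commutes with the
          differentials, and the lower block enters with a minus sign.\<close>
        have "mat_vec (?R (Suc i)) (?D i) ?f c = mat_vec (p (Suc i)) (A i) ?f c + mat_vec (q i) (\<phi> i) (\<lambda>b. ?f (p (Suc i) + b)) c"
          using mat_vec_cone_upper[of c p i] True by simp
        also have "mat_vec (p (Suc i)) (A i) ?f c = mat_vec (p (Suc i)) (A i) (\<lambda>b. mat_vec (p (Suc (Suc i))) (A (Suc i)) z b + mat_vec (q (Suc i)) (\<phi> (Suc i)) y b) c"
          by (rule mat_vec_cong) (use up in auto)
        also have "\<dots> = mat_vec (q i) (\<phi> i) (mat_vec (q (Suc i)) (B i) y) c"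
          using F.mat_vec_square[OF True] comm_mv[OF True] by (simp add: mat_vec_add)
        also have "mat_vec (q i) (\<phi> i) (\<lambda>b. ?f (p (Suc i) + b)) c = - mat_vec (q i) (\<phi> i) (mat_vec (q (Suc i)) (B i) y) c"
          unfolding low mat_vec_uminus by simp
        finally show ?thesis by simp
      next
        case False
        then obtain j where j: "i = Suc j" using c by (cases i) auto
        then obtain c' where c': "c = p (Suc j) + c'" "c' < q j"
          using c False le_Suc_ex[of "p (Suc j)" c] by auto
        have "mat_vec (?R (Suc i)) (?D i) ?f c = - mat_vec (q (Suc j)) (B j) (\<lambda>b. ?f (p (Suc i) + b)) c'"
          using mat_vec_cone_lower[of p j "q (Suc j)" A B \<phi> ?f c'] c' j by simp
        also have "\<dots> = mat_vec (q (Suc j)) (B j) (mat_vec (q (Suc (Suc j))) (B (Suc j)) y) c'"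
          unfolding low mat_vec_uminus by (simp add: j)
        also have "\<dots> = 0" using G.mat_vec_square[OF c'(2)] .
        finally show ?thesis .
      qed
    qed
  qed (use p0 \<delta>0 in auto)
  then show ?thesis by (rule that)
qed

section \<open>Counting generators\<close>

definition above :: "nat set \<Rightarrow> nat \<Rightarrow> nat" where
  "above \<sigma> t = card {w \<in> \<sigma>. t < w}"

text \<open>Counts the generators \<open>x\<^sub>u x\<^sub>v\<close> (\<open>u < v \<in> \<sigma>\<close>) whose colon ideal is generated
  by exactly \<open>i - 1\<close> indeterminates, i.e. \<open>u + above \<sigma> v = i - 1\<close>; there is at most one \<open>u\<close>
  for each \<open>v\<close>.\<close>

definition gen_count :: "nat set \<Rightarrow> nat \<Rightarrow> nat" where
  "gen_count \<sigma> i = card {v \<in> \<sigma>. above \<sigma> v < i \<and> i \<le> above \<sigma> v + v}"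

lemma above_less:
  assumes "finite \<sigma>" "v \<in> \<sigma>" "t < v"
  shows "above \<sigma> v < above \<sigma> t"
  unfolding above_def using assms by (intro psubset_card_mono) auto

lemma above_le:
  assumes "finite \<sigma>" "t \<le> v"
  shows "above \<sigma> t \<le> above \<sigma> v + card (\<sigma> \<inter> {t<..v})"
proof -
  have "{w \<in> \<sigma>. t < w} \<subseteq> {w \<in> \<sigma>. v < w} \<union> (\<sigma> \<inter> {t<..v})" by auto
  then have "card {w \<in> \<sigma>. t < w} \<le> card ({w \<in> \<sigma>. v < w} \<union> (\<sigma> \<inter> {t<..v}))"
    using assms by (intro card_mono) auto
  then show ?thesis unfolding above_def using card_Un_le le_trans by blast
qed

text \<open>As \<open>s\<close> grows by 1, the function \<open>s + above \<sigma> s\<close> stays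
  constant if the new \<open>s\<close> is in \<open>\<sigma>\<close> and rises by 1 otherwise. As
  \<open>t\<close> itself is such a rise, all \<open>v < t\<close> have strictly smaller values than
  \<open>t\<close>, and all \<open>v > t\<close> at least the same value. Hence exactly the elements
  of \<open>\<sigma>\<close> beyond \<open>t\<close> are counted.\<close>

lemma gen_count_notin:
  assumes "finite \<sigma>" "t \<notin> \<sigma>"
  shows "gen_count \<sigma> (t + above \<sigma> t) = above \<sigma> t"
proof -
  have "{v \<in> \<sigma>. above \<sigma> v < t + above \<sigma> t \<and> t + above \<sigma> t \<le> above \<sigma> v + v} = {v \<in> \<sigma>. t < v}"
  proof (intro Collect_cong conj_cong refl)
    fix v assume v: "v \<in> \<sigma>"
    show "above \<sigma> v < t + above \<sigma> t \<and> t + above \<sigma> t \<le> above \<sigma> v + v \<longleftrightarrow> t < v"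
    proof (cases "t < v")
      case True
      have "card (\<sigma> \<inter> {t<..v}) \<le> card {t<..v}" by (intro card_mono) auto
      then show ?thesis
        using above_less[OF assms(1) v True] above_le[OF assms(1), of t v] True by simp
    next
      case False
      then have "v < t" using v assms(2) by (metis linorder_neqE_nat)
      have "\<sigma> \<inter> {v<..t} \<subseteq> {v<..<t}" using assms(2) by (auto simp: order.order_iff_strict)
      then have "card (\<sigma> \<inter> {v<..t}) \<le> card {v<..<t}" by (intro card_mono) auto
      then have "card (\<sigma> \<inter> {v<..t}) + v < t" using \<open>v < t\<close> by simp
      then show ?thesis
        using above_le[OF assms(1), of v t] \<open>v < t\<close> by linarith
    qed
  qed
  then show ?thesis by (simp add: gen_count_def above_def)
qed

text \<open>\<open>above\<close> numbers the elements of \<open>\<sigma>\<close> downwards by 0,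
  ..., \<open>card \<sigma> - 1\<close>. The elements not beyond \<open>v\<close> lie in
  \<open>{1..v}\<close>, so \<open>above \<sigma> v + v\<close> is at least
  \<open>card \<sigma>\<close> and the upper bound in \<open>gen_count\<close> holds for every
  \<open>v\<close>.\<close>

lemma gen_count_le_card:
  assumes fin: "finite \<sigma>" and pos: "0 \<notin> \<sigma>" and k: "k \<le> card \<sigma>"
  shows "gen_count \<sigma> k = k"
proof -
  have inj: "inj_on (above \<sigma>) \<sigma>"
    by (rule inj_onI) (metis above_less[OF fin] less_irrefl linorder_neqE_nat)
  have "above \<sigma> ` \<sigma> \<subseteq> {..<card \<sigma>}"
  proof
    fix x assume "x \<in> above \<sigma> ` \<sigma>"
    then obtain v where "v \<in> \<sigma>" "x = above \<sigma> v" by auto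
    moreover have "above \<sigma> v < card \<sigma>"
      unfolding above_def using \<open>v \<in> \<sigma>\<close> fin by (intro psubset_card_mono) auto
    ultimately show "x \<in> {..<card \<sigma>}" by simp
  qed
  then have img: "above \<sigma> ` \<sigma> = {..<card \<sigma>}"
    by (intro card_subset_eq) (simp_all add: card_image[OF inj])
  have "{v \<in> \<sigma>. above \<sigma> v < k \<and> k \<le> above \<sigma> v + v} = {v \<in> \<sigma>. above \<sigma> v < k}"
  proof -
    have "card \<sigma> \<le> above \<sigma> v + v" for v
    proof -
      have "\<sigma> = {w \<in> \<sigma>. 0 < w}" using pos by (auto intro: gr0I)
      then have "card \<sigma> = above \<sigma> 0" by (simp add: above_def)
      moreover have "card (\<sigma> \<inter> {0<..v}) \<le> card {0<..v}" by (intro card_mono) auto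
      ultimately show ?thesis using above_le[OF fin, of 0 v] by simp
    qed
    with k show ?thesis using le_trans by blast
  qed
  moreover have "card {v \<in> \<sigma>. above \<sigma> v < k} = card (above \<sigma> ` {v \<in> \<sigma>. above \<sigma> v < k})"
    by (intro card_image[symmetric] inj_on_subset[OF inj]) auto
  moreover have "above \<sigma> ` {v \<in> \<sigma>. above \<sigma> v < k} = {..<k}"
    using img k by (auto simp: image_iff set_eq_iff) (metis lessThan_iff less_le_trans image_iff)
  ultimately show ?thesis by (simp add: gen_count_def)
qed

text \<open>The function \<open>s + above \<sigma> s\<close> runs from \<open>card \<sigma>\<close>
  at 0 to \<open>n\<close> at \<open>n\<close> in steps of 0 or 1, rising exactly at points outside
  \<open>\<sigma>\<close>. Every \<open>k\<close> with \<open>card \<sigma> < k \<le> n\<close> is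
  thus attained at some \<open>s\<close> outside \<open>\<sigma>\<close>, where
  \<open>k - gen_count \<sigma> k = s\<close>; smaller \<open>k\<close> give 0.\<close>

lemma complement_eq_gen_count:
  assumes \<sigma>: "\<sigma> \<subseteq> {1..n}"
  shows "t \<in> {1..n} - \<sigma> \<longleftrightarrow> 1 \<le> t \<and> (\<exists>k\<in>{1..n}. k = t + gen_count \<sigma> k)"
proof
  have fin: "finite \<sigma>" using \<sigma> finite_subset by blast
  {
    assume t: "t \<in> {1..n} - \<sigma>"
    have "above \<sigma> t \<le> card {t<..n}"
      unfolding above_def using \<sigma> by (intro card_mono) auto
    then have "above \<sigma> t + t \<le> n" using t by auto
    then have "t + above \<sigma> t \<in> {1..n}" using t by (simp add: add.commute)
    then show "1 \<le> t \<and> (\<exists>k\<in>{1..n}. k = t + gen_count \<sigma> k)"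
      using t gen_count_notin[OF fin, of t] by (intro conjI bexI[of _ "t + above \<sigma> t"]) auto
  }
  assume "1 \<le> t \<and> (\<exists>k\<in>{1..n}. k = t + gen_count \<sigma> k)"
  then obtain k where t: "1 \<le> t" and k: "k \<in> {1..n}" "k = t + gen_count \<sigma> k" by blast
  have card_lt: "card \<sigma> < k"
  proof (rule ccontr)
    assume "\<not> card \<sigma> < k"
    then have "gen_count \<sigma> k = k" using \<sigma> fin by (intro gen_count_le_card) auto
    then show False using t k by simp
  qed
  \<comment> \<open>The first point reaching the value \<open>k\<close> is a rise, hence lies
    outside \<open>\<sigma>\<close> and attains \<open>k\<close> exactly.\<close>
  define s where "s = (LEAST s. k \<le> s + above \<sigma> s)"
  have "k \<le> n + above \<sigma> n" using k by simp
  then have s: "k \<le> s + above \<sigma> s" and s_le: "s \<le> n"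
    unfolding s_def by (rule LeastI, rule Least_le)
  have "above \<sigma> 0 \<le> card \<sigma>" unfolding above_def using fin by (intro card_mono) auto
  then have "s \<noteq> 0" using card_lt s by (cases s) auto
  then obtain s' where s': "s = Suc s'" by (cases s) auto
  have less: "s' + above \<sigma> s' < k"
    using not_less_Least[of s' "\<lambda>s. k \<le> s + above \<sigma> s"] s' by (simp add: s_def not_le)
  have "s \<notin> \<sigma>"
  proof
    assume "s \<in> \<sigma>"
    then have "above \<sigma> s < above \<sigma> s'" using above_less[OF fin] s' by simp
    then show False using less s s' by simp
  qed
  moreover have "above \<sigma> s \<le> above \<sigma> s'"
    unfolding above_def using fin s' by (intro card_mono) auto
  ultimately have "k = s + above \<sigma> s" using less s s' by simp
  then have "t = s" using k(2) gen_count_notin[OF fin \<open>s \<notin> \<sigma>\<close>] by simp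
  then show "t \<in> {1..n} - \<sigma>" using s_le t \<open>s \<notin> \<sigma>\<close> by simp
qed

lemma gen_count_inj:
  assumes "\<sigma> \<subseteq> {1..n}" "\<sigma>' \<subseteq> {1..n}" "\<And>k. k \<in> {1..n} \<Longrightarrow> gen_count \<sigma> k = gen_count \<sigma>' k"
  shows "\<sigma> = \<sigma>'"
proof -
  have "{1..n} - \<sigma> = {1..n} - \<sigma>'"
    using complement_eq_gen_count[OF assms(1)] complement_eq_gen_count[OF assms(2)] assms(3)
    by (intro set_eqI) (metis (no_types, lifting))
  then show ?thesis using assms(1,2) by blast
qed

text \<open>The differences \<open>k - lam k\<close> vanish up to some index and then increase
  strictly. If \<open>t = k - lam k\<close> is positive, the larger differences come from the
  \<open>n - k\<close> indices after \<open>k\<close>; so \<open>(n - t) - (n - k) = lam k\<close>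
  elements of \<open>\<sigma>\<close> lie beyond \<open>t\<close>, and
  \<open>gen_count_notin\<close> applies.\<close>

lemma gen_count_of_composition:
  fixes lam :: "nat \<Rightarrow> int"
  assumes lam1: "lam 1 \<le> 1" and lamn: "0 \<le> lam n"
    and step: "\<And>i. 1 \<le> i \<Longrightarrow> i < n \<Longrightarrow> lam (Suc i) * int i \<le> lam i * int (Suc i)"
    and \<sigma>: "\<sigma> = {1..n} - {j. int j \<in> {int k - lam k | k. k \<in> {1..n}} - {0}}"
    and k: "k \<in> {1..n}"
  shows "int (gen_count \<sigma> k) = lam k"
proof -
  \<comment> \<open>The ratio inequalities carry nonnegativity down from \<open>n\<close> and, in
    the next step, the upper bound up from 1.\<close>
  have nonneg: "0 \<le> lam i" if "1 \<le> i" "i \<le> n" for i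
    using that(2,1)
  proof (induction rule: inc_induct)
    case (step i)
    then have "0 \<le> lam (Suc i) * int i" by simp
    also have "\<dots> \<le> lam i * int (Suc i)" using assms(3) step by simp
    finally show ?case by (simp add: zero_le_mult_iff)
  qed (use lamn in simp)
  have le: "lam i \<le> int i" if "1 \<le> i" "i \<le> n" for i
    using that
  proof (induction i rule: dec_induct)
    case (step i)
    then have "lam (Suc i) * int i \<le> lam i * int (Suc i)" using assms(3) by simp
    also have "\<dots> \<le> int i * int (Suc i)" using step by (intro mult_right_mono) auto
    finally show ?case using step by (simp add: mult.commute)
  qed (use lam1 in simp)
  \<comment> \<open>Once positive, \<open>D\<close> is strictly increasing, because \<open>lam i < i\<close> forces \<open>lam (i + 1) \<le> lam i\<close>.\<close>
  define D where "D = (\<lambda>i. nat (int i - lam i))"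
  have D: "int (D i) = int i - lam i" if "1 \<le> i" "i \<le> n" for i
    using le[OF that] by (simp add: D_def)
  have D_step: "D i < D (Suc i)" if "1 \<le> i" "i < n" "0 < D i" for i
  proof -
    have "lam i < int i" using D[of i] that by simp
    then have "lam (Suc i) * int i < lam i * int i + int i"
      using step[of i] that by (simp add: algebra_simps)
    then have "lam (Suc i) * int i < (lam i + 1) * int i" by (simp add: algebra_simps)
    then have "lam (Suc i) \<le> lam i" using that by (simp add: mult_less_cancel_right)
    then have "int (D i) < int (D (Suc i))" using D[of i] D[of "Suc i"] that by simp
    then show ?thesis by simp
  qed
  have D_less: "D i < D j" if "1 \<le> i" "i < j" "j \<le> n" "0 < D i" for i j
    using that(2,3)
  proof (induction j)
    case (Suc j)
    show ?case
    proof (cases "i = j")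
      case True
      then show ?thesis using D_step that Suc by simp
    next
      case False
      then have "D i < D j" using Suc by simp
      also have "D j < D (Suc j)" using D_step[of j] Suc that \<open>D i < D j\<close> by simp
      finally show ?thesis .
    qed
  qed simp
  define \<tau> where "\<tau> = {1..n} - \<sigma>"
  have \<tau>: "\<tau> = D ` {1..n} - {0}"
  proof (intro equalityI subsetI)
    fix t assume "t \<in> \<tau>"
    then obtain k where "k \<in> {1..n}" "int t = int k - lam k" "t \<noteq> 0"
      by (auto simp: \<tau>_def \<sigma>)
    then show "t \<in> D ` {1..n} - {0}" by (auto simp: D_def intro!: image_eqI[of _ _ k])
  next
    fix t assume "t \<in> D ` {1..n} - {0}"
    then obtain k where k: "1 \<le> k" "k \<le> n" "t = D k" "t \<noteq> 0" by auto
    then have "int t = int k - lam k" "t \<le> n" using D[of k] nonneg[of k] by auto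
    then show "t \<in> \<tau>" using k by (auto simp: \<tau>_def \<sigma>)
  qed
  have fin: "finite \<sigma>" "finite \<tau>" and sub: "\<sigma> \<subseteq> {1..n}" by (auto simp: \<sigma> \<tau>_def)
  show ?thesis
  proof (cases "D k = 0")
    case True
    \<comment> \<open>If the difference vanishes at \<open>k\<close>, all nonzero differences come
      from later indices; so \<open>\<tau>\<close> has at most \<open>n - k\<close> elements and
      \<open>k \<le> card \<sigma>\<close>.\<close>
    have "\<tau> \<subseteq> D ` {k<..n}"
    proof
      fix t assume "t \<in> \<tau>"
      then obtain j where j: "1 \<le> j" "j \<le> n" "t = D j" "D j \<noteq> 0" using \<tau> by auto
      have "k < j"
      proof (rule ccontr)
        assume "\<not> k < j"
        then have "j < k" using j True by (cases "j = k") auto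
        then show False using D_less[of j k] j k True by simp
      qed
      then show "t \<in> D ` {k<..n}" using j by auto
    qed
    then have "card \<tau> \<le> card {k<..n}" by (metis card_image_le card_mono finite_greaterThanAtMost finite_imageI le_trans)
    moreover have "card \<tau> = n - card \<sigma>" unfolding \<tau>_def using sub fin by (subst card_Diff_subset) auto
    ultimately have "k \<le> card \<sigma>" using k by simp linarith
    then have "gen_count \<sigma> k = k" using sub fin by (intro gen_count_le_card) auto
    then show ?thesis using True D[of k] k by simp
  next
    case False
    define t where "t = D k"
    have "t \<in> \<tau>" using \<tau> False k by (auto simp: t_def)
    then have t: "t \<in> \<tau>" "t \<le> n" "t \<notin> \<sigma>" by (auto simp: \<tau>_def)
    have img: "{w \<in> \<tau>. t < w} = D ` {k<..n}"
    proof (intro equalityI subsetI)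
      fix w assume "w \<in> {w \<in> \<tau>. t < w}"
      then obtain j where j: "1 \<le> j" "j \<le> n" "w = D j" "D j \<noteq> 0" "D k < D j" using \<tau> by (auto simp: t_def)
      have "k < j"
        using D_less[of j k] j k by (metis atLeastAtMost_iff gr0I less_asym less_irrefl linorder_neqE_nat)
      then show "w \<in> D ` {k<..n}" using j by auto
    next
      fix w assume "w \<in> D ` {k<..n}"
      then obtain j where j: "k < j" "j \<le> n" "w = D j" by auto
      then have "D k < D j" using D_less[of k j] k False by simp
      then show "w \<in> {w \<in> \<tau>. t < w}" using j k \<tau> by (auto simp: t_def)
    qed
    have "inj_on D {k<..n}"
    proof (rule linorder_inj_onI')
      fix i j assume "i \<in> {k<..n}" "j \<in> {k<..n}" "i < j"
      moreover have "0 < D i" using D_less[of k i] \<open>i \<in> {k<..n}\<close> False k by simp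
      ultimately have "D i < D j" using D_less[of i j] k by simp
      then show "D i \<noteq> D j" by simp
    qed
    then have card_\<tau>: "card {w \<in> \<tau>. t < w} = n - k" by (simp add: img card_image)
    have "{t<..n} = {w \<in> \<sigma>. t < w} \<union> {w \<in> \<tau>. t < w}" using sub by (auto simp: \<tau>_def)
    then have "card {t<..n} = card {w \<in> \<sigma>. t < w} + card {w \<in> \<tau>. t < w}"
      using fin by (simp add: card_Un_disjoint \<tau>_def disjoint_iff)
    then have "n - t = above \<sigma> t + (n - k)" by (simp add: above_def card_\<tau>)
    moreover have "int t = int k - lam k" "0 \<le> lam k" using D[of k] k nonneg[of k] by (auto simp: t_def)
    ultimately have "k = t + above \<sigma> t" "int (above \<sigma> t) = lam k" using k t(2) by auto
    then show ?thesis using gen_count_notin[OF fin(1) t(3)] by simp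
  qed
qed

section \<open>Betti numbers of threshold graphs\<close>

definition var_monomials :: "nat set \<Rightarrow> (nat \<Rightarrow>\<^sub>0 nat) set" where
  "var_monomials C = {m. Poly_Mapping.keys m \<inter> C \<noteq> {}}"

text \<open>For pairs of distinct indices, the exponents of the monomials in an edge ideal; the
  generators are squarefree, so the support decides membership.\<close>

definition pair_monomials :: "(nat \<times> nat) set \<Rightarrow> (nat \<Rightarrow>\<^sub>0 nat) set" where
  "pair_monomials P = {m. \<exists>(u, v)\<in>P. u \<in> Poly_Mapping.keys m \<and> v \<in> Poly_Mapping.keys m}"

abbreviation var_monom :: "nat \<Rightarrow> nat \<Rightarrow>\<^sub>0 nat" where
  "var_monom v \<equiv> Poly_Mapping.single v 1"

lemma range_var: "range ((+) (var_monom x)) = {m :: nat \<Rightarrow>\<^sub>0 nat. x \<in> Poly_Mapping.keys m}"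
proof (intro equalityI subsetI)
  fix m :: "nat \<Rightarrow>\<^sub>0 nat" assume "m \<in> {m. x \<in> Poly_Mapping.keys m}"
  then have "m = var_monom x + (m - var_monom x)"
    by (intro poly_mapping_eqI) (auto simp: lookup_add lookup_minus lookup_single in_keys_iff when_def)
  then show "m \<in> range ((+) (var_monom x))" by (metis rangeI)
qed (auto simp: keys_add_monomial)

lemma range_var_pair:
  assumes "u \<noteq> v"
  shows "range ((+) (var_monom u + var_monom v)) = {m :: nat \<Rightarrow>\<^sub>0 nat. u \<in> Poly_Mapping.keys m \<and> v \<in> Poly_Mapping.keys m}"
proof (intro equalityI subsetI)
  fix m :: "nat \<Rightarrow>\<^sub>0 nat" assume "m \<in> {m. u \<in> Poly_Mapping.keys m \<and> v \<in> Poly_Mapping.keys m}"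
  then have "m = (var_monom u + var_monom v) + (m - (var_monom u + var_monom v))"
    using assms
    by (intro poly_mapping_eqI) (auto simp: lookup_add lookup_minus lookup_single in_keys_iff when_def)
  then show "m \<in> range ((+) (var_monom u + var_monom v))" by (metis rangeI)
qed (auto simp: keys_add_monomial)

text \<open>The Koszul complex as an iterated cone: a new indeterminate is a nonzerodivisor modulo
  the others, so the colon ideal is the old ideal and the ranks add by Pascal's rule.\<close>

lemma koszul_resolution:
  assumes "finite C" "C \<subseteq> V"
  shows "\<exists>A. graded_resolution V (mono_ideal V (var_monomials C)) (\<lambda>i. card C choose i) (\<lambda>i _. i) A (\<lambda>_. 1 :: 'k::field mpoly)"
  using assms
proof (induction C rule: finite_induct)
  case empty
  have "(\<lambda>i. 0 choose i) = (\<lambda>i. if i = 0 then 1 else 0)"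
    by (rule ext) (auto simp: binomial_eq_0)
  moreover have "var_monomials {} = {}" by (simp add: var_monomials_def)
  ultimately show ?case
    using resolution_zero_ideal[of "\<lambda>i. i" V] by auto
next
  case (insert x C)
  then obtain A where A: "graded_resolution V (mono_ideal V (var_monomials C)) (\<lambda>i. card C choose i) (\<lambda>i _. i) A (\<lambda>_. 1 :: 'k mpoly)"
    by auto
  have colon: "{m. var_monom x + m \<in> var_monomials C} = var_monomials C"
    using insert by (auto simp: var_monomials_def keys_add_monomial)
  have ins: "var_monomials C \<union> range ((+) (var_monom x)) = var_monomials (insert x C)"
    unfolding range_var by (auto simp: var_monomials_def)
  have rank: "cone_rank (\<lambda>i. card C choose i) (\<lambda>i. card C choose i) = (\<lambda>i. card (insert x C) choose i)"
  proof
    fix i show "cone_rank (\<lambda>i. card C choose i) (\<lambda>i. card C choose i) i = card (insert x C) choose i"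
      using insert by (cases i) simp_all
  qed
  obtain D where "graded_resolution V (mono_ideal V (var_monomials C \<union> range ((+) (var_monom x))))
      (cone_rank (\<lambda>i. card C choose i) (\<lambda>i. card C choose i)) (\<lambda>i _. i) D (\<lambda>_. 1 :: 'k mpoly)"
  proof (rule mapping_cone_resolution[OF A, where a = "var_monom x" and q = "\<lambda>i. card C choose i" and \<gamma> = "\<lambda>i. i" and B = A])
    show "graded_resolution V (mono_ideal V {m. var_monom x + m \<in> var_monomials C}) (\<lambda>i. card C choose i) (\<lambda>i _. i) A (\<lambda>_. 1)"
      unfolding colon by (rule A)
    show "m' + m \<in> var_monomials C" if "m \<in> var_monomials C" for m m'
      using that by (auto simp: var_monomials_def keys_add_monomial)
  qed (use insert.prems in auto)
  then show ?case unfolding ins rank by blast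
qed

text \<open>The generator degrees 0, 2, 3, 4, ... of a 2-linear resolution.\<close>

definition linear_shift :: "nat \<Rightarrow> nat" where
  "linear_shift i = (if i = 0 then 0 else Suc i)"

text \<open>The hypotheses on \<open>C\<close> say that the colon ideal of the old ideal by \<open>x\<^sub>u x\<^sub>v\<close> is generated by
  the indeterminates in \<open>C\<close>.\<close>

lemma linear_quotient_step:
  assumes F: "graded_resolution V (mono_ideal V (pair_monomials P)) r (\<lambda>i _. linear_shift i) A (\<lambda>_. 1 :: 'k::field mpoly)"
    and r0: "r 0 = 1" and uv: "u \<noteq> v" "u \<in> V" "v \<in> V" and C: "finite C" "C \<subseteq> V" "u \<notin> C" "v \<notin> C"
    and pairs: "\<And>a b. (a, b) \<in> P \<Longrightarrow> a \<in> C \<or> b \<in> C"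
    and vars: "\<And>c. c \<in> C \<Longrightarrow> \<exists>(a, b)\<in>P. {a, b} \<subseteq> {u, v, c}"
  shows "\<exists>D. graded_resolution V (mono_ideal V (pair_monomials (insert (u, v) P)))
    (cone_rank r (\<lambda>i. card C choose i)) (\<lambda>i _. linear_shift i) D (\<lambda>_. 1 :: 'k mpoly)"
proof -
  obtain B where B: "graded_resolution V (mono_ideal V (var_monomials C)) (\<lambda>i. card C choose i) (\<lambda>i _. i) B (\<lambda>_. 1 :: 'k mpoly)"
    using koszul_resolution[OF C(1,2)] by blast
  have colon: "{m. (var_monom u + var_monom v) + m \<in> pair_monomials P} = var_monomials C"
  proof (intro equalityI subsetI)
    fix m assume "m \<in> {m. (var_monom u + var_monom v) + m \<in> pair_monomials P}"
    then obtain a b where "(a, b) \<in> P" "a \<in> {u, v} \<union> Poly_Mapping.keys m" "b \<in> {u, v} \<union> Poly_Mapping.keys m"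
      by (auto simp: pair_monomials_def keys_add_monomial)
    then show "m \<in> var_monomials C"
      using pairs[of a b] C by (auto simp: var_monomials_def)
  next
    fix m assume "m \<in> var_monomials C"
    then obtain c where c: "c \<in> C" "c \<in> Poly_Mapping.keys m" by (auto simp: var_monomials_def)
    obtain a b where "(a, b) \<in> P" "{a, b} \<subseteq> {u, v, c}" using vars[OF c(1)] by blast
    then show "m \<in> {m. (var_monom u + var_monom v) + m \<in> pair_monomials P}"
      using c(2) by (auto simp: pair_monomials_def keys_add_monomial intro!: bexI[of _ "(a, b)"])
  qed
  have ins: "pair_monomials P \<union> range ((+) (var_monom u + var_monom v)) = pair_monomials (insert (u, v) P)"
    unfolding range_var_pair[OF uv(1)] by (auto simp: pair_monomials_def)
  \<comment> \<open>The Koszul shift \<open>i\<close> plus the degree 2 of the new generator equals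
    \<open>linear_shift (Suc i)\<close>, so the cone stays linear.\<close>
  obtain D where "graded_resolution V (mono_ideal V (pair_monomials P \<union> range ((+) (var_monom u + var_monom v))))
      (cone_rank r (\<lambda>i. card C choose i)) (\<lambda>i _. linear_shift i) D (\<lambda>_. 1 :: 'k mpoly)"
  proof (rule mapping_cone_resolution[OF F, where a = "var_monom u + var_monom v" and q = "\<lambda>i. card C choose i" and \<gamma> = "\<lambda>i. i" and B = B])
    show "graded_resolution V (mono_ideal V {m. (var_monom u + var_monom v) + m \<in> pair_monomials P}) (\<lambda>i. card C choose i) (\<lambda>i _. i) B (\<lambda>_. 1)"
      unfolding colon by (rule B)
    show "m' + m \<in> pair_monomials P" if "m \<in> pair_monomials P" for m m'
      using that by (auto simp: pair_monomials_def keys_add_monomial)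
  qed (use r0 uv in \<open>auto simp: linear_shift_def mdeg_add keys_add_monomial\<close>)
  then show ?thesis unfolding ins by blast
qed

text \<open>\<open>u + above \<sigma> v\<close> indeterminates generate the colon ideal at the
  generator with indices \<open>u\<close> and \<open>v\<close>; the cone places its
  \<open>j\<close>-th Koszul module in position \<open>j + 1\<close>.\<close>

definition threshold_rank :: "nat set \<Rightarrow> nat \<Rightarrow> nat" where
  "threshold_rank \<sigma> i = (case i of 0 \<Rightarrow> 1 | Suc j \<Rightarrow> (\<Sum>v\<in>\<sigma>. \<Sum>u<v. (u + above \<sigma> v) choose j))"

definition threshold_pairs :: "(nat \<Rightarrow> nat) \<Rightarrow> nat set \<Rightarrow> (nat \<times> nat) set" where
  "threshold_pairs f \<sigma> = {(f u, f v) | u v. u < v \<and> v \<in> \<sigma>}"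

text \<open>The generators \<open>x\<^sub>u x\<^sub>v\<close> (\<open>u < v \<in> \<sigma>\<close>) are added with \<open>v\<close> descending and, for fixed \<open>v\<close>,
  \<open>u\<close> ascending; the colon ideals are then generated by the \<open>x\<^sub>a\<close> with \<open>a < u\<close> and the \<open>x\<^sub>b\<close> with
  \<open>v < b \<in> \<sigma>\<close>.\<close>

lemma threshold_resolution:
  assumes inj: "inj_on f {0..n}" and V: "f ` {0..n} \<subseteq> V" and \<sigma>: "\<sigma> \<subseteq> {0..n}"
  shows "\<exists>A. graded_resolution V (mono_ideal V (pair_monomials (threshold_pairs f \<sigma>)))
    (threshold_rank \<sigma>) (\<lambda>i _. linear_shift i) A (\<lambda>_. 1 :: 'k::field mpoly)"
proof -
  have "finite \<sigma>" using \<sigma> finite_subset by blast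
  then show ?thesis using \<sigma>
  proof (induction \<sigma> rule: finite_linorder_min_induct)
    case empty
    have "threshold_rank {} = (\<lambda>i. if i = 0 then 1 else 0)"
      by (rule ext) (simp add: threshold_rank_def split: nat.splits)
    then show ?case
      using resolution_zero_ideal[of linear_shift V]
      by (auto simp: threshold_pairs_def pair_monomials_def linear_shift_def)
  next
    case (insert v \<sigma>)
    then have v: "v \<le> n" and \<sigma>: "\<sigma> \<subseteq> {v<..n}" by force+
    \<comment> \<open>Ideal and ranks after the generators with second index \<open>v\<close> and
      first index below \<open>k\<close> have been added. All of \<open>\<sigma>\<close> lies beyond
      \<open>v\<close>, whence \<open>card \<sigma>\<close> in the binomials.\<close>
    define P where "P = (\<lambda>k. threshold_pairs f \<sigma> \<union> (\<lambda>u. (f u, f v)) ` {..<k})"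
    define r where "r = (\<lambda>k i. case i of 0 \<Rightarrow> 1 | Suc j \<Rightarrow> threshold_rank \<sigma> (Suc j) + (\<Sum>u<k. (u + card \<sigma>) choose j))"
    have "\<exists>A. graded_resolution V (mono_ideal V (pair_monomials (P k))) (r k) (\<lambda>i _. linear_shift i) A (\<lambda>_. 1 :: 'k mpoly)"
      if "k \<le> v" for k
      using that
    proof (induction k)
      case 0
      have "r 0 = threshold_rank \<sigma>" by (rule ext) (simp add: r_def threshold_rank_def split: nat.splits)
      moreover have "P 0 = threshold_pairs f \<sigma>" by (simp add: P_def)
      ultimately show ?case using insert.IH insert.prems by auto
    next
      case (Suc u)
      then obtain A where A: "graded_resolution V (mono_ideal V (pair_monomials (P u))) (r u) (\<lambda>i _. linear_shift i) A (\<lambda>_. 1 :: 'k mpoly)"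
        by auto
      define C where "C = f ` ({..<u} \<union> \<sigma>)"
      have sub: "{..<u} \<union> \<sigma> \<subseteq> {0..n}" using Suc.prems v \<sigma> by auto
      have f_eq: "f x = f y \<longleftrightarrow> x = y" if "x \<le> n" "y \<le> n" for x y
        using inj_on_eq_iff[OF inj, of x y] that by simp
      have "card C = card ({..<u} \<union> \<sigma>)"
        unfolding C_def by (intro card_image inj_on_subset[OF inj] sub)
      also have "\<dots> = u + card \<sigma>"
        using \<sigma> Suc.prems insert.hyps(1) by (subst card_Un_disjoint) auto
      finally have card_C: "card C = u + card \<sigma>" .
      have "\<exists>D. graded_resolution V (mono_ideal V (pair_monomials (insert (f u, f v) (P u))))
        (cone_rank (r u) (\<lambda>i. card C choose i)) (\<lambda>i _. linear_shift i) D (\<lambda>_. 1 :: 'k mpoly)"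
      proof (rule linear_quotient_step[OF A])
        show "r u 0 = 1" by (simp add: r_def)
        show "f u \<noteq> f v" using f_eq Suc.prems v by simp
        show "f u \<in> V" "f v \<in> V" using V Suc.prems v by auto
        show "finite C" "C \<subseteq> V" using sub V insert.hyps(1) by (auto simp: C_def)
        show "f u \<notin> C"
        proof
          assume "f u \<in> C"
          then obtain x where "x \<in> {..<u} \<union> \<sigma>" "f u = f x" by (auto simp: C_def)
          then show False using f_eq[of u x] sub Suc.prems v \<sigma> by auto
        qed
        show "f v \<notin> C"
        proof
          assume "f v \<in> C"
          then obtain x where "x \<in> {..<u} \<union> \<sigma>" "f v = f x" by (auto simp: C_def)
          then show False using f_eq[of v x] sub Suc.prems v \<sigma> by auto
        qed
        show "a \<in> C \<or> b \<in> C" if "(a, b) \<in> P u" for a b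
          using that by (auto simp: P_def C_def threshold_pairs_def)
        show "\<exists>(a, b)\<in>P u. {a, b} \<subseteq> {f u, f v, c}" if "c \<in> C" for c
        proof -
          obtain x where x: "c = f x" "x < u \<or> x \<in> \<sigma>" using \<open>c \<in> C\<close> by (auto simp: C_def)
          from x(2) show ?thesis
          proof
            assume "x < u"
            then have "(f x, f v) \<in> P u" by (auto simp: P_def)
            then show ?thesis using x by blast
          next
            assume "x \<in> \<sigma>"
            then have "u < x" using \<sigma> Suc.prems by auto
            then have "(f u, f x) \<in> P u" using \<open>x \<in> \<sigma>\<close> by (auto simp: P_def threshold_pairs_def)
            then show ?thesis using x by blast
          qed
        qed
      qed
      moreover have "insert (f u, f v) (P u) = P (Suc u)"
        by (auto simp: P_def lessThan_Suc)
      moreover have "cone_rank (r u) (\<lambda>i. card C choose i) = r (Suc u)"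
      proof
        fix i show "cone_rank (r u) (\<lambda>i. card C choose i) i = r (Suc u) i"
          by (cases i) (simp_all add: r_def card_C)
      qed
      ultimately show ?case by simp
    qed
    from this[of v] obtain A where "graded_resolution V (mono_ideal V (pair_monomials (P v))) (r v) (\<lambda>i _. linear_shift i) A (\<lambda>_. 1 :: 'k mpoly)"
      by blast
    moreover have "P v = threshold_pairs f (insert v \<sigma>)"
      by (auto simp: P_def threshold_pairs_def)
    moreover have "r v = threshold_rank (insert v \<sigma>)"
    proof
      fix i
      have "{w. (w = v \<or> w \<in> \<sigma>) \<and> v < w} = \<sigma>" using \<sigma> by auto
      then have 1: "above (insert v \<sigma>) v = card \<sigma>" by (simp add: above_def)
      have 2: "above (insert v \<sigma>) w = above \<sigma> w" if "w \<in> \<sigma>" for w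
      proof -
        have "{x \<in> insert v \<sigma>. w < x} = {x \<in> \<sigma>. w < x}" using that \<sigma> by auto
        then show ?thesis by (simp add: above_def)
      qed
      have "v \<notin> \<sigma>" using \<sigma> by auto
      then show "r v i = threshold_rank (insert v \<sigma>) i"
        using insert.hyps(1) by (cases i) (simp_all add: r_def threshold_rank_def 1 2)
    qed
    ultimately show ?case by auto
  qed
qed

section \<open>From the ideal of non-edges to the composition\<close>

lemma indet_mult: "indet u * indet v = (Poly_Mapping.single (var_monom u + var_monom v) 1 :: 'k::field mpoly)"
  by (simp add: indet_def mult_single)

lemma ideal_generated_pairs:
  assumes P: "P \<subseteq> V \<times> V" "\<And>u v. (u, v) \<in> P \<Longrightarrow> u \<noteq> v"
  shows "ideal_generated V {indet u * indet v | u v. (u, v) \<in> P} = (mono_ideal V (pair_monomials P) :: 'k::field mpoly set)"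
    (is "ideal_generated V ?B = ?I")
proof (intro equalityI subsetI)
  have I: "homogeneous_ideal V ?I"
    by (rule homogeneous_ideal_mono_ideal) (auto simp: pair_monomials_def keys_add_monomial)
  fix p :: "'k mpoly" assume "p \<in> ideal_generated V ?B"
  then obtain c B' where p: "p = (\<Sum>g\<in>B'. c g * g)" "finite B'" "B' \<subseteq> ?B" "\<And>g. g \<in> B' \<Longrightarrow> c g \<in> poly_ring V"
    by (auto simp: ideal_generated_def)
  have B: "g \<in> ?I" if g: "g \<in> ?B" for g
  proof -
    obtain u v where uv: "(u, v) \<in> P" "g = indet u * indet v" using g by blast
    then have "Poly_Mapping.keys g = {var_monom u + var_monom v}" by (simp add: indet_mult)
    moreover have "Poly_Mapping.keys (var_monom u + var_monom v) = {u, v}" by (auto simp: keys_add_monomial)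
    ultimately show ?thesis
      using uv(1) P(1) by (auto simp: mono_ideal_def poly_ring_def pair_monomials_def)
  qed
  show "p \<in> ?I"
    unfolding p(1) using p(2-4)
  proof (induction B' rule: finite_induct)
    case empty
    then show ?case using I by (simp add: homogeneous_ideal_def)
  next
    case (insert g B')
    have "c g * g \<in> ?I" using I insert.prems B by (auto simp: homogeneous_ideal_def)
    then show ?case using I insert by (auto simp: homogeneous_ideal_def)
  qed
next
  fix p :: "'k mpoly" assume p: "p \<in> ?I"
  have "\<forall>m. \<exists>u v. m \<in> Poly_Mapping.keys p \<longrightarrow> (u, v) \<in> P \<and> u \<in> Poly_Mapping.keys m \<and> v \<in> Poly_Mapping.keys m"
    using p by (fastforce simp: mono_ideal_def pair_monomials_def)
  then obtain U W where UW: "\<And>m. m \<in> Poly_Mapping.keys p \<Longrightarrow>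
      (U m, W m) \<in> P \<and> U m \<in> Poly_Mapping.keys m \<and> W m \<in> Poly_Mapping.keys m"
    by metis
  define g :: "(nat \<Rightarrow>\<^sub>0 nat) \<Rightarrow> 'k mpoly" where "g = (\<lambda>m. indet (U m) * indet (W m))"
  define h where "h = (\<lambda>m. Poly_Mapping.single (m - (var_monom (U m) + var_monom (W m))) (Poly_Mapping.lookup p m))"
  \<comment> \<open>Several terms of \<open>p\<close> may select the same generator, but
    \<open>ideal_generated\<close> provides one coefficient per generator; so the quotients are
    collected.\<close>
  define c where "c = (\<lambda>b. \<Sum>m\<in>{m \<in> Poly_Mapping.keys p. g m = b}. h m)"
  have hg: "h m * g m = Poly_Mapping.single m (Poly_Mapping.lookup p m)" if m: "m \<in> Poly_Mapping.keys p" for m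
  proof -
    have "m \<in> range ((+) (var_monom (U m) + var_monom (W m)))"
      using UW[OF m] range_var_pair[of "U m" "W m"] P(2) by auto
    then obtain m' where "m = (var_monom (U m) + var_monom (W m)) + m'" by blast
    then have "m - (var_monom (U m) + var_monom (W m)) + (var_monom (U m) + var_monom (W m)) = m"
      by (metis add.commute add_diff_cancel_left')
    then show ?thesis by (simp add: h_def g_def indet_mult mult_single)
  qed
  have "p = (\<Sum>m\<in>Poly_Mapping.keys p. h m * g m)"
    using sum_singles[of p] hg by simp
  also have "\<dots> = (\<Sum>b\<in>g ` Poly_Mapping.keys p. \<Sum>m\<in>{m \<in> Poly_Mapping.keys p. g m = b}. h m * g m)"
    by (rule sum.image_gen) simp
  also have "\<dots> = (\<Sum>b\<in>g ` Poly_Mapping.keys p. c b * b)"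
    unfolding c_def sum_distrib_right by (intro sum.cong) auto
  finally have "p = (\<Sum>b\<in>g ` Poly_Mapping.keys p. c b * b)" .
  moreover have "g ` Poly_Mapping.keys p \<subseteq> ?B" using UW by (auto simp: g_def)
  moreover have "c b \<in> poly_ring V" for b
    unfolding c_def
  proof (intro poly_ring_sum)
    fix m assume "m \<in> {m \<in> Poly_Mapping.keys p. g m = b}"
    then have "Poly_Mapping.keys m \<subseteq> V" using p by (auto simp: mono_ideal_def poly_ring_def)
    moreover have "Poly_Mapping.keys (m - (var_monom (U m) + var_monom (W m))) \<subseteq> Poly_Mapping.keys m"
      by (auto simp: in_keys_iff lookup_minus)
    ultimately show "h m \<in> poly_ring V" unfolding h_def by (intro poly_ring_single) auto
  qed
  ultimately show "p \<in> ideal_generated V ?B"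
    unfolding ideal_generated_def
    by (intro CollectI exI[of _ c] exI[of _ "g ` Poly_Mapping.keys p"]) simp
qed

text \<open>For positive \<open>i\<close> all generators of the \<open>i\<close>-th module have
  degree \<open>i + 1\<close>, so the graded Betti number is the whole rank.\<close>

lemma betti_seq_threshold:
  assumes inj: "inj_on f {0..n}" and V: "fst T = f ` {0..n}" and \<sigma>: "\<sigma> \<subseteq> {0..n}"
    and E: "\<And>u v. u < v \<Longrightarrow> v \<le> n \<Longrightarrow> {f u, f v} \<in> snd T \<longleftrightarrow> v \<notin> \<sigma>"
    and i: "1 \<le> i"
  shows "betti_seq TYPE('k::field) T i = threshold_rank \<sigma> i"
proof -
  define P where "P = {(u, v). u \<in> fst T \<and> v \<in> fst T \<and> u \<noteq> v \<and> {u, v} \<notin> snd T}"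
  have f_eq: "f x = f y \<longleftrightarrow> x = y" if "x \<le> n" "y \<le> n" for x y
    using inj_on_eq_iff[OF inj, of x y] that by simp
  have "nonedge_ideal T = (ideal_generated (fst T) {indet u * indet v | u v. (u, v) \<in> P} :: 'k mpoly set)"
    by (simp add: nonedge_ideal_def P_def)
  also have "\<dots> = mono_ideal (fst T) (pair_monomials P)"
    by (rule ideal_generated_pairs) (auto simp: P_def)
  also have "pair_monomials P = pair_monomials (threshold_pairs f \<sigma>)"
  proof (intro equalityI subsetI)
    fix m assume "m \<in> pair_monomials P"
    then obtain a b where ab: "a \<le> n" "b \<le> n" "f a \<noteq> f b" "{f a, f b} \<notin> snd T" "f a \<in> Poly_Mapping.keys m" "f b \<in> Poly_Mapping.keys m"
      by (auto simp: pair_monomials_def P_def V)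
    show "m \<in> pair_monomials (threshold_pairs f \<sigma>)"
    proof (cases "a < b")
      case True
      then have "(f a, f b) \<in> threshold_pairs f \<sigma>" using E[of a b] ab by (auto simp: threshold_pairs_def)
      then show ?thesis using ab by (auto simp: pair_monomials_def intro!: bexI[of _ "(f a, f b)"])
    next
      case False
      then have "b < a" using ab by (metis linorder_neqE_nat)
      then have "(f b, f a) \<in> threshold_pairs f \<sigma>" using E[of b a] ab by (auto simp: threshold_pairs_def insert_commute)
      then show ?thesis using ab by (auto simp: pair_monomials_def intro!: bexI[of _ "(f b, f a)"])
    qed
  next
    fix m assume "m \<in> pair_monomials (threshold_pairs f \<sigma>)"
    then obtain u v where uv: "u < v" "v \<in> \<sigma>" "f u \<in> Poly_Mapping.keys m" "f v \<in> Poly_Mapping.keys m"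
      by (auto simp: pair_monomials_def threshold_pairs_def)
    then have "v \<le> n" using \<sigma> by auto
    then have "(f u, f v) \<in> P" using uv E[of u v] f_eq[of u v] by (auto simp: P_def V)
    then show "m \<in> pair_monomials P" using uv unfolding pair_monomials_def by blast
  qed
  finally have I: "nonedge_ideal T = (mono_ideal (fst T) (pair_monomials (threshold_pairs f \<sigma>)) :: 'k mpoly set)" .
  obtain A where A: "graded_resolution (fst T) (nonedge_ideal T) (threshold_rank \<sigma>) (\<lambda>i _. linear_shift i) A (\<lambda>_. 1 :: 'k mpoly)"
    using threshold_resolution[OF inj _ \<sigma>, of "fst T"] V unfolding I by auto
  interpret graded_resolution "fst T" "nonedge_ideal T" "threshold_rank \<sigma>" "\<lambda>i _. linear_shift i" A "\<lambda>_. 1 :: 'k mpoly"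
    by (fact A)
  have "minimal_resolution (fst T) (nonedge_ideal T) (threshold_rank \<sigma>) (\<lambda>i _. linear_shift i) A (\<lambda>_. 1 :: 'k mpoly)"
  proof unfold_locales
    fix a b i assume "a < threshold_rank \<sigma> i" "b < threshold_rank \<sigma> (Suc i)"
    \<comment> \<open>The shifts increase strictly, so every entry of a differential is homogeneous
      of positive degree.\<close>
    then have "\<forall>m\<in>Poly_Mapping.keys (A i a b). mdeg m + linear_shift i = linear_shift (Suc i)"
      using graded_mat[of i] by (auto simp: graded_mat_def)
    then have "0 \<notin> Poly_Mapping.keys (A i a b)" by (auto simp: linear_shift_def split: if_splits)
    then show "const_coeff (A i a b) = 0" by (simp add: in_keys_iff)
  qed
  from graded_betti_eq[OF this] show ?thesis
    using i by (simp add: betti_seq_def linear_shift_def)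
qed

text \<open>With \<open>e = i - 1\<close> and \<open>k = i + t\<close>, trinomial revision extracts
  \<open>c choose e\<close> and leaves the alternating sum over row \<open>c - e\<close> of Pascal's
  triangle, which vanishes unless \<open>c = e\<close>. The bound \<open>c < n\<close> ensures that
  the sum up to \<open>n\<close> covers the whole row.\<close>

lemma binomial_inversion:
  assumes "1 \<le> i" "i \<le> n" "c < n"
  shows "(\<Sum>k=i..n. (-1) ^ (i + k) * int ((k - 1) choose (i - 1)) * int (c choose (k - 1))) = (if c = i - 1 then 1 else 0)"
proof (cases "c < i - 1")
  case True
  then have "c choose (k - 1) = 0" if "k \<in> {i..n}" for k
    using that by (intro binomial_eq_0) auto
  then have "(\<Sum>k=i..n. (-1) ^ (i + k) * int ((k - 1) choose (i - 1)) * int (c choose (k - 1))) = 0"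
    by (intro sum.neutral) simp
  then show ?thesis using True by simp
next
  case False
  define e where "e = i - 1"
  have i: "i = Suc e" using assms by (simp add: e_def)
  have e: "e \<le> c" using False by (simp add: e_def)
  have "(\<Sum>k=i..n. (-1) ^ (i + k) * int ((k - 1) choose (i - 1)) * int (c choose (k - 1)))
      = (\<Sum>t=0..n-i. (-1) ^ t * (int (c choose e) * int ((c - e) choose t)))"
    unfolding sum.atLeastAtMost_shift_0[OF assms(2)]
  proof (intro sum.cong refl)
    fix t
    have "((e + t) choose e) * (c choose (e + t)) = (c choose e) * ((c - e) choose t)"
    proof (cases "e + t \<le> c")
      case True
      then show ?thesis using choose_mult[of e "e + t" c] by (simp add: mult.commute)
    next
      case False
      then have "c - e < t" using e by simp
      then show ?thesis using False by (simp add: binomial_eq_0)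
    qed
    then have "int ((e + t) choose e) * int (c choose (e + t)) = int (c choose e) * int ((c - e) choose t)"
      by (metis of_nat_mult)
    moreover have "(-1 :: int) ^ (i + (i + t)) = (-1) ^ t"
      by (simp add: power_add flip: power_mult_distrib)
    ultimately show "((\<lambda>k. (-1) ^ (i + k) * int ((k - 1) choose (i - 1)) * int (c choose (k - 1))) \<circ> (+) i) t
        = (-1) ^ t * (int (c choose e) * int ((c - e) choose t))"
      by (simp add: i mult.assoc)
  qed
  also have "\<dots> = int (c choose e) * (\<Sum>t=0..n-i. (-1) ^ t * int ((c - e) choose t))"
    unfolding sum_distrib_left by (simp add: mult_ac)
  also have "(\<Sum>t=0..n-i. (-1) ^ t * int ((c - e) choose t)) = (\<Sum>t\<le>c-e. (-1) ^ t * int ((c - e) choose t))"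
    using assms(3) i e by (intro sum.mono_neutral_right) (auto simp: binomial_eq_0)
  also have "\<dots> = (if c = e then 1 else 0)"
    using choose_alternating_sum[of "c - e", where 'a = int] e by simp
  finally show ?thesis by (simp add: e_def)
qed

lemma sum_generators_eq_gen_count:
  assumes "finite \<sigma>" "1 \<le> i"
  shows "(\<Sum>v\<in>\<sigma>. \<Sum>u<v. if u + above \<sigma> v = i - 1 then 1 else 0) = int (gen_count \<sigma> i)"
proof -
  have "(\<Sum>u<v. if u + above \<sigma> v = i - 1 then 1 else 0 :: int)
      = (if above \<sigma> v < i \<and> i \<le> above \<sigma> v + v then 1 else 0)" for v
  proof (cases "above \<sigma> v < i")
    case True
    then have "(u + above \<sigma> v = i - 1) = (u = i - 1 - above \<sigma> v)" for u by auto
    then show ?thesis using True by (auto simp: not_le)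
  next
    case False
    then have "(u + above \<sigma> v = i - 1) = False" for u using assms by auto
    then show ?thesis using False by simp
  qed
  then show ?thesis
    using assms(1) by (simp add: gen_count_def sum.If_cases Int_def)
qed

lemma lambda_comp_threshold:
  assumes inj: "inj_on f {0..n}" and V: "fst T = f ` {0..n}" and \<sigma>: "\<sigma> \<subseteq> {1..n}"
    and E: "\<And>u v. u < v \<Longrightarrow> v \<le> n \<Longrightarrow> {f u, f v} \<in> snd T \<longleftrightarrow> v \<notin> \<sigma>"
    and i: "i \<in> {1..n}"
  shows "lambda_comp TYPE('k::field) n T i = int (gen_count \<sigma> i)"
proof -
  have fin: "finite \<sigma>" using \<sigma> finite_subset by blast
  have betti: "int (betti_seq TYPE('k) T k) = (\<Sum>v\<in>\<sigma>. \<Sum>u<v. int ((u + above \<sigma> v) choose (k - 1)))"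
    if k: "1 \<le> k" for k
  proof -
    obtain j where "k = Suc j" using k by (cases k) auto
    then show ?thesis
      using betti_seq_threshold[OF inj V _ E k, where 'k = 'k] \<sigma>
      by (simp add: threshold_rank_def subset_iff)
  qed
  let ?c = "\<lambda>k. (-1) ^ (i + k) * int ((k - 1) choose (i - 1))"
  have "lambda_comp TYPE('k) n T i = (\<Sum>k=i..n. \<Sum>v\<in>\<sigma>. \<Sum>u<v. ?c k * int ((u + above \<sigma> v) choose (k - 1)))"
    unfolding lambda_comp_def using i by (intro sum.cong) (simp_all add: betti sum_distrib_left)
  also have "\<dots> = (\<Sum>v\<in>\<sigma>. \<Sum>k=i..n. \<Sum>u<v. ?c k * int ((u + above \<sigma> v) choose (k - 1)))"
    by (rule sum.swap)
  also have "\<dots> = (\<Sum>v\<in>\<sigma>. \<Sum>u<v. \<Sum>k=i..n. ?c k * int ((u + above \<sigma> v) choose (k - 1)))"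
    by (intro sum.cong refl sum.swap)
  also have "\<dots> = (\<Sum>v\<in>\<sigma>. \<Sum>u<v. if u + above \<sigma> v = i - 1 then 1 else 0)"
  proof (intro sum.cong refl)
    fix v u assume v: "v \<in> \<sigma>" and u: "u \<in> {..<v}"
    \<comment> \<open>At most \<open>n - v\<close> elements of \<open>\<sigma>\<close> exceed
      \<open>v\<close>, and \<open>u < v\<close>; this gives the strict bound required for the
      inversion.\<close>
    have "above \<sigma> v \<le> card {v<..n}"
      unfolding above_def using \<sigma> by (intro card_mono) auto
    moreover have "v \<le> n" using v \<sigma> by auto
    ultimately have "u + above \<sigma> v < n" using u by simp
    then show "(\<Sum>k=i..n. ?c k * int ((u + above \<sigma> v) choose (k - 1))) = (if u + above \<sigma> v = i - 1 then 1 else 0)"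
      using binomial_inversion i by simp
  qed
  also have "\<dots> = int (gen_count \<sigma> i)"
    using sum_generators_eq_gen_count[OF fin] i by simp
  finally show ?thesis .
qed

section \<open>Labellings of arbitrary threshold graphs\<close>

text \<open>\<open>f\<close> lists the vertices in order of construction and \<open>\<sigma>\<close>
  records the isolated steps; the first vertex has no type, so 0 is not in \<open>\<sigma>\<close>.
  The last clause excludes loops and edges outside the vertex set, which the clause on pairs cannot
  detect.\<close>

definition threshold_labelling :: "nat \<Rightarrow> nat set \<Rightarrow> (nat \<Rightarrow> 'v) \<Rightarrow> 'v graph \<Rightarrow> bool" where
  "threshold_labelling n \<sigma> f G \<longleftrightarrow> \<sigma> \<subseteq> {1..n} \<and> inj_on f {0..n} \<and> fst G = f ` {0..n} \<and>
     (\<forall>u v. u < v \<longrightarrow> v \<le> n \<longrightarrow> ({f u, f v} \<in> snd G \<longleftrightarrow> v \<notin> \<sigma>)) \<and>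
     (\<forall>e\<in>snd G. e \<subseteq> fst G \<and> card e = 2)"

text \<open>One statement for both kinds of steps: the new vertex is joined to all old vertices or
  to none, according to whether \<open>Suc n\<close> is in \<open>\<sigma>'\<close>.\<close>

lemma threshold_labelling_extend:
  assumes L: "threshold_labelling n \<sigma> f (V, E)" and x: "x \<notin> V"
    and E': "\<And>e. x \<notin> e \<Longrightarrow> e \<in> E' \<longleftrightarrow> e \<in> E" "\<And>u. u \<in> V \<Longrightarrow> {u, x} \<in> E' \<longleftrightarrow> Suc n \<notin> \<sigma>'"
      "\<And>e. e \<in> E' \<Longrightarrow> e \<subseteq> insert x V \<and> card e = 2"
    and \<sigma>': "\<sigma>' = \<sigma> \<or> \<sigma>' = insert (Suc n) \<sigma>"
  shows "threshold_labelling (Suc n) \<sigma>' (f(Suc n := x)) (insert x V, E')"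
proof -
  let ?f = "f(Suc n := x)"
  have \<sigma>: "\<sigma> \<subseteq> {1..n}" and inj: "inj_on f {0..n}" and V: "V = f ` {0..n}"
    and E: "\<And>u v. u < v \<Longrightarrow> v \<le> n \<Longrightarrow> {f u, f v} \<in> E \<longleftrightarrow> v \<notin> \<sigma>"
    using L by (auto simp: threshold_labelling_def)
  have img: "?f ` {0..n} = V" unfolding V by (rule image_cong) auto
  have set: "{0..Suc n} = insert (Suc n) {0..n}" by auto
  show ?thesis
    unfolding threshold_labelling_def fst_conv snd_conv
  proof (intro conjI allI impI ballI)
    show "\<sigma>' \<subseteq> {1..Suc n}" using \<sigma> \<sigma>' by auto
    have "inj_on ?f {0..n}" using inj by (subst inj_on_cong[of _ _ f]) auto
    then show "inj_on ?f {0..Suc n}"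
      unfolding set inj_on_insert using img x by simp
    show "insert x V = ?f ` {0..Suc n}" unfolding set image_insert img by simp
    fix u v assume uv: "u < v" "v \<le> Suc n"
    show "{?f u, ?f v} \<in> E' \<longleftrightarrow> v \<notin> \<sigma>'"
    proof (cases "v = Suc n")
      case True
      then show ?thesis using E'(2)[of "f u"] uv V by auto
    next
      case False
      then have "f u \<in> V" "f v \<in> V" using uv V by auto
      then have "x \<notin> {f u, f v}" using x by auto
      then show ?thesis using E'(1)[of "{f u, f v}"] E[of u v] uv False \<sigma>' by auto
    qed
  qed (use E'(3) in auto)
qed

lemma threshold_graph_labelling:
  assumes "threshold_graph G"
  shows "\<exists>n \<sigma> f. threshold_labelling n \<sigma> f G"
  using assms
proof (induction rule: threshold_graph.induct)
  case (single_vertex v)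
  have "threshold_labelling 0 {} (\<lambda>_. v) ({v}, {})"
    by (auto simp: threshold_labelling_def)
  then show ?case by blast
next
  case (add_isolated V E x)
  then obtain n \<sigma> f where L: "threshold_labelling n \<sigma> f (V, E)" by blast
  then have E: "\<And>e. e \<in> E \<Longrightarrow> e \<subseteq> V \<and> card e = 2"
    unfolding threshold_labelling_def fst_conv snd_conv by blast
  have "threshold_labelling (Suc n) (insert (Suc n) \<sigma>) (f(Suc n := x)) (insert x V, E)"
    by (rule threshold_labelling_extend[OF L]) (use E add_isolated.hyps in blast)+
  then show ?case by blast
next
  case (add_dominating V E x)
  then obtain n \<sigma> f where L: "threshold_labelling n \<sigma> f (V, E)" by blast
  then have E: "\<And>e. e \<in> E \<Longrightarrow> e \<subseteq> V \<and> card e = 2"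
    unfolding threshold_labelling_def fst_conv snd_conv by blast
  have "Suc n \<notin> \<sigma>" using L by (auto simp: threshold_labelling_def)
  have "threshold_labelling (Suc n) \<sigma> (f(Suc n := x)) (insert x V, E \<union> {{u, x} |u. u \<in> V})"
  proof (rule threshold_labelling_extend[OF L])
    fix e assume "e \<in> E \<union> {{u, x} |u. u \<in> V}"
    then show "e \<subseteq> insert x V \<and> card e = 2"
      using E[of e] add_dominating.hyps(2) by (auto simp: card_insert_if)
  qed (use E add_dominating.hyps \<open>Suc n \<notin> \<sigma>\<close> in blast)+
  then show ?case by blast
qed

lemma doubleton_in_T_graph:
  assumes "a < b" "b \<le> n"
  shows "{a, b} \<in> snd (T_graph n \<sigma>) \<longleftrightarrow> b \<notin> \<sigma>"
  using assms by (auto simp: T_graph_def doubleton_eq_iff)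

lemma T_graph_labelling:
  assumes "\<sigma> \<subseteq> {1..n}"
  shows "threshold_labelling n \<sigma> (\<lambda>v. v) (T_graph n \<sigma>)"
  unfolding threshold_labelling_def
proof (intro conjI allI impI ballI)
  fix e assume "e \<in> snd (T_graph n \<sigma>)"
  then show "e \<subseteq> fst (T_graph n \<sigma>)" "card e = 2" by (auto simp: T_graph_def)
qed (use assms doubleton_in_T_graph in \<open>auto simp: T_graph_def\<close>)

lemma threshold_graph_T_graph: "threshold_graph (T_graph n \<sigma>)"
proof (induction n)
  case 0
  have "T_graph 0 \<sigma> = ({0}, {})" by (auto simp: T_graph_def)
  then show ?case by (simp add: threshold_graph.single_vertex)
next
  case (Suc n)
  let ?V = "{0..n}" and ?E = "snd (T_graph n \<sigma>)"
  have IH: "threshold_graph (?V, ?E)" using Suc by (simp add: T_graph_def)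
  have V: "{0..Suc n} = insert (Suc n) ?V" by auto
  show ?case
  proof (cases "Suc n \<in> \<sigma>")
    case True
    then have "T_graph (Suc n) \<sigma> = (insert (Suc n) ?V, ?E)"
      unfolding T_graph_def V by (auto simp: le_Suc_eq)
    then show ?thesis using threshold_graph.add_isolated[OF IH, of "Suc n"] by simp
  next
    case False
    then have "T_graph (Suc n) \<sigma> = (insert (Suc n) ?V, ?E \<union> {{u, Suc n} | u. u \<in> ?V})"
    proof -
      have "{u, Suc n} \<in> snd (T_graph (Suc n) \<sigma>)" if "u \<le> n" for u
        using that False doubleton_in_T_graph[of u "Suc n"] by simp
      moreover have "snd (T_graph (Suc n) \<sigma>) \<subseteq> ?E \<union> {{u, Suc n} | u. u \<in> ?V}"
        by (auto simp: T_graph_def le_Suc_eq)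
      moreover have "?E \<subseteq> snd (T_graph (Suc n) \<sigma>)" by (auto simp: T_graph_def intro: le_SucI)
      ultimately have "snd (T_graph (Suc n) \<sigma>) = ?E \<union> {{u, Suc n} | u. u \<in> ?V}" by auto
      then show ?thesis using V by (simp add: T_graph_def)
    qed
    then show ?thesis using threshold_graph.add_dominating[OF IH, of "Suc n"] by simp
  qed
qed

lemma graph_iso_T_graph:
  assumes L: "threshold_labelling n \<sigma> f G"
  shows "graph_iso G (T_graph n \<sigma>)"
proof -
  have inj: "inj_on f {0..n}" and V: "fst G = f ` {0..n}"
    and E: "\<And>u v. u < v \<Longrightarrow> v \<le> n \<Longrightarrow> {f u, f v} \<in> snd G \<longleftrightarrow> v \<notin> \<sigma>"
    and card: "\<And>e. e \<in> snd G \<Longrightarrow> card e = 2"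
    using L by (auto simp: threshold_labelling_def)
  let ?g = "inv_into {0..n} f"
  have g: "?g (f a) = a" if "a \<le> n" for a using inj that by simp
  have edge: "{f a, f b} \<in> snd G \<longleftrightarrow> {a, b} \<in> snd (T_graph n \<sigma>)" if "a \<le> n" "b \<le> n" for a b
  proof -
    consider "a < b" | "b < a" | "a = b" by linarith
    then show ?thesis
    proof cases
      case 1
      then show ?thesis using that E[of a b] doubleton_in_T_graph[of a b n \<sigma>] by simp
    next
      case 2
      then show ?thesis using that E[of b a] doubleton_in_T_graph[of b a n \<sigma>] by (simp add: insert_commute)
    next
      \<comment> \<open>\<open>graph_iso\<close> also compares the degenerate pairs with
        \<open>u = v\<close>, which are singletons and hence no edges.\<close>
      case 3
      have "{f a} \<notin> snd G" using card[of "{f a}"] by auto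
      moreover have "{a} \<notin> snd (T_graph n \<sigma>)" by (auto simp: T_graph_def)
      ultimately show ?thesis using 3 by simp
    qed
  qed
  have "bij_betw ?g (fst G) (fst (T_graph n \<sigma>))"
    using bij_betw_inv_into[of f "{0..n}" "fst G"] inj V by (simp add: bij_betw_def T_graph_def)
  moreover have "\<forall>u\<in>fst G. \<forall>v\<in>fst G. {u, v} \<in> snd G \<longleftrightarrow> {?g u, ?g v} \<in> snd (T_graph n \<sigma>)"
    unfolding V using g edge by auto
  ultimately show ?thesis unfolding graph_iso_def by blast
qed

lemma lambda_comp_labelling:
  assumes "threshold_labelling n \<sigma> f T" "i \<in> {1..n}"
  shows "lambda_comp TYPE('k::field) n T i = int (gen_count \<sigma> i)"
  using assms by (intro lambda_comp_threshold[of f]) (auto simp: threshold_labelling_def)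

theorem theorem3p10:
  fixes n :: nat and lam :: "nat \<Rightarrow> int" and \<sigma> :: "nat set"
  assumes "n \<ge> 1"
    and "anti_lecture_hall_upto_1 n lam"
    and "\<sigma> = {1..n} - {j. int j \<in> {int k - lam k | k. k \<in> {1..n}} - {0}}"
  shows "is_T_of TYPE('k::field) n lam (T_graph n \<sigma>)"
proof -
  have \<sigma>: "\<sigma> \<subseteq> {1..n}" using assms(3) by blast
  have "lam 1 \<le> 1" using assms(2) by (simp add: anti_lecture_hall_upto_1_def)
  moreover have "0 \<le> lam n"
    using assms(1,2) by (auto simp: anti_lecture_hall_upto_1_def zero_le_divide_iff)
  moreover have "lam (Suc i) * int i \<le> lam i * int (Suc i)" if "1 \<le> i" "i < n" for i
  proof -
    have "real_of_int (lam (i + 1)) / real (i + 1) \<le> real_of_int (lam i) / real i"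
      using assms(2) that by (auto simp: anti_lecture_hall_upto_1_def)
    then have "real_of_int (lam (Suc i)) * real i \<le> real_of_int (lam i) * real (Suc i)"
      using that by (simp add: divide_le_eq le_divide_eq mult.commute del: of_nat_Suc)
    then have "real_of_int (lam (Suc i) * int i) \<le> real_of_int (lam i * int (Suc i))"
      by (simp del: of_nat_Suc)
    then show ?thesis by (simp only: of_int_le_iff)
  qed
  ultimately have count: "int (gen_count \<sigma> k) = lam k" if "k \<in> {1..n}" for k
    using gen_count_of_composition[of lam n \<sigma> k] assms(3) that by blast
  show ?thesis
    unfolding is_T_of_def threshold_graph_with_comp_def
  proof (intro conjI allI impI ballI)
    show "threshold_graph (T_graph n \<sigma>)" by (rule threshold_graph_T_graph)
    show "card (fst (T_graph n \<sigma>)) = n + 1" by (simp add: T_graph_def)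
    show "lambda_comp TYPE('k) n (T_graph n \<sigma>) i = lam i" if "i \<in> {1..n}" for i
      using lambda_comp_labelling[OF T_graph_labelling[OF \<sigma>] that] count[OF that] by simp
  next
    fix T' :: "nat graph"
    assume T': "threshold_graph T' \<and> card (fst T') = n + 1 \<and> (\<forall>i\<in>{1..n}. lambda_comp TYPE('k) n T' i = lam i)"
    \<comment> \<open>A competitor also has a labelling; its number of vertices fixes
      \<open>m\<close>, its composition fixes the counts, and these determine
      \<open>\<sigma>'\<close>.\<close>
    then obtain m \<sigma>' f where L: "threshold_labelling m \<sigma>' f T'"
      using threshold_graph_labelling by blast
    then have "card (fst T') = m + 1" by (simp add: threshold_labelling_def card_image)
    then have "m = n" using T' by simp
    note L = L[unfolded this]
    have "gen_count \<sigma>' k = gen_count \<sigma> k" if k: "k \<in> {1..n}" for k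
      using lambda_comp_labelling[OF L k, where 'k = 'k] count[OF k] T' k by simp
    then have "\<sigma>' = \<sigma>"
      using L \<sigma> by (intro gen_count_inj[of _ n]) (auto simp: threshold_labelling_def)
    then show "graph_iso T' (T_graph n \<sigma>)" using graph_iso_T_graph[OF L] by simp
  qed
qed

end
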